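(* Let $S$ be a countable right LCM semigroup, let $N\colon S\to[1,+\infty)$ be a nontrivial scale on $S$ and let $\beta\in\mathbb{R}$. Necessary conditions for the existence of a Borel probability measure $\mu$ on $\widehat{E(S)}$ satisfying $$\mu(\lambda_s\cdot A)=N(s)^{-\beta}\mu(A)\quad\text{for all Borel } A\subset\widehat{E(S)} \text{ and all } s\in S$$ (and hence for the existence of a $\sigma^N$-KMS$_\beta$-state on $C^*(S)$) are that either $\beta=0$, or that $\beta>0$ and the following holds: for any $s\in S$ and $t\in\ker N$, we have $sS\cap tS=rS$ for some $r\in s(\ker N)$.
   Context: A right LCM semigroup is a left cancellative semigroup $S$ with identity element $e$ such that for all $s,t\in S$ either $sS\cap tS=\emptyset$ or $sS\cap tS=rS$ for some $r\in S$. A scale on $S$ is a semigroup homomorphism $N\colon S\to([1,+\infty),\cdot)$; it is nontrivial if it is not identically $1$; $\ker N:=N^{-1}(1)$. $C^*(S)$ is the (universal) C$^*$-algebra generated by isometries $v_s$, $s\in S$, with relations $v_e=1$, $v_sv_t=v_{st}$, and $v_sv_s^*v_tv_t^*=v_rv_r^*$ if $sS\cap tS=rS$, $v_sv_s^*v_tv_t^*=0$ if $sS\cap tS=\emptyset$. The dynamics $\sigma^N$ is given by $\sigma^N_t(v_s)=N(s)^{it}v_s$. A $\sigma^N$-KMS$_\beta$-state is a state $\varphi$ on $C^*(S)$ such that $\varphi(ab)=\varphi(b\,\sigma^N_{i\beta}(a))$ for all $a,b$ in a dense subspace of $\sigma^N$-analytic elements. For $s\in S$ let $\lambda_s\colon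 S\to sS$, $t\mapsto st$, viewed as a partial bijection of $S$, and let $e_s:=\lambda_s\lambda_s^{-1}$ (the identity map on $sS$). $E(S):=\{e_s\mid s\in S\}\cup\{0\}$ is a semilattice under composition, where $0$ is the empty partial map. $\widehat{E(S)}$ is the compact space (topology of pointwise convergence) of nonzero semigroup homomorphisms $\chi\colon E(S)\to\{0,1\}$ with $\chi(0)=0$. For $\chi\in\widehat{E(S)}$ and $s\in S$, the character $\lambda_s\cdot\chi$ is defined by $(\lambda_s\cdot\chi)(e_r)=\chi(\lambda_s^{-1}e_r\lambda_s)$, and $\lambda_s\cdot A=\{\lambda_s\cdot\chi\mid\chi\in A\}$.
   Formalization: In the definition of a KMS state the dense subspace of analytic elements is additionally required to be invariant under the dynamics; without this the claim fails, e.g. for S = (ℕ,+), N(n) = eⁿ, β = −1 and evaluation at 1 on C(𝕋). *)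

theory Defs
  imports "HOL-Probability.Probability" "HOL-Library.Poly_Mapping"
begin

section \<open>Right LCM semigroups and scales\<close>

abbreviation (in monoid_mult) right_ideal :: "'a \<Rightarrow> 'a set" where
  "right_ideal s \<equiv> range ((*) s)"

class right_LCM_semigroup = monoid_mult +
  assumes left_cancel: "a * b = a * c \<Longrightarrow> b = c"
    and right_LCM: "right_ideal a \<inter> right_ideal b = {} \<or>
      (\<exists>c. right_ideal a \<inter> right_ideal b = right_ideal c)"

definition semigroup_scale :: "('s::monoid_mult \<Rightarrow> real) \<Rightarrow> bool" where
  "semigroup_scale N \<longleftrightarrow> (\<forall>s. 1 \<le> N s) \<and> (\<forall>s t. N (s * t) = N s * N t)"

definition scale_kernel :: "('s::monoid_mult \<Rightarrow> real) \<Rightarrow> 's set" where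
  "scale_kernel N = {s. N s = 1}"


section \<open>The semilattice $E(S)$ and its spectrum\<close>

definition left_mult :: "'s::monoid_mult \<Rightarrow> 's \<rightharpoonup> 's" where
  "left_mult s = (\<lambda>t. Some (s * t))"

definition partial_inv :: "('s \<rightharpoonup> 's) \<Rightarrow> ('s \<rightharpoonup> 's)" where
  "partial_inv f = (\<lambda>y. if y \<in> ran f then Some (THE x. f x = Some y) else None)"

definition idem :: "'s::monoid_mult \<Rightarrow> 's \<rightharpoonup> 's" where
  "idem s = left_mult s \<circ>\<^sub>m partial_inv (left_mult s)"

definition idem_semilattice :: "('s::monoid_mult \<rightharpoonup> 's) set" where
  "idem_semilattice = insert Map.empty (range idem)"

text \<open>Characters are made extensional, i.e. undefined off the semilattice, so that
  a character is determined by its values there.\<close>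

definition spectrum :: "(('s::monoid_mult \<rightharpoonup> 's) \<Rightarrow> nat) set" where
  "spectrum = {\<xi> \<in> idem_semilattice \<rightarrow>\<^sub>E {0, 1}.
     (\<exists>e\<in>idem_semilattice. \<xi> e \<noteq> 0) \<and>
     (\<forall>e\<in>idem_semilattice. \<forall>f\<in>idem_semilattice. \<xi> (e \<circ>\<^sub>m f) = \<xi> e * \<xi> f) \<and>
     \<xi> Map.empty = 0}"

definition spectrum_topology :: "(('s::monoid_mult \<rightharpoonup> 's) \<Rightarrow> nat) topology" where
  "spectrum_topology =
     subtopology (product_topology (\<lambda>_. discrete_topology {0, 1}) idem_semilattice) spectrum"

definition spectrum_borel :: "(('s::monoid_mult \<rightharpoonup> 's) \<Rightarrow> nat) measure" where
  "spectrum_borel = sigma (topspace spectrum_topology) {U. openin spectrum_topology U}"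

definition spectrum_action ::
    "'s::monoid_mult \<Rightarrow> (('s \<rightharpoonup> 's) \<Rightarrow> nat) \<Rightarrow> (('s \<rightharpoonup> 's) \<Rightarrow> nat)" where
  "spectrum_action s \<xi> =
     (\<lambda>e\<in>idem_semilattice. \<xi> (partial_inv (left_mult s) \<circ>\<^sub>m e \<circ>\<^sub>m left_mult s))"

definition scaling_measure ::
    "('s::monoid_mult \<Rightarrow> real) \<Rightarrow> real \<Rightarrow> (('s \<rightharpoonup> 's) \<Rightarrow> nat) measure \<Rightarrow> bool" where
  "scaling_measure N \<beta> \<mu> \<longleftrightarrow> prob_space \<mu> \<and> sets \<mu> = sets spectrum_borel \<and>
     (\<forall>A\<in>sets spectrum_borel. \<forall>s.
        measure \<mu> (spectrum_action s ` A) = N s powr (- \<beta>) * measure \<mu> A)"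


section \<open>Unital C*-algebras\<close>

text \<open>The zero algebra is not excluded, which is why this does not extend
  \<^class>\<open>real_normed_algebra_1\<close>.\<close>

class cstar_algebra = real_normed_algebra + monoid_mult + banach +
  fixes scaleC :: "complex \<Rightarrow> 'a \<Rightarrow> 'a" (infixr \<open>*\<^sub>C\<close> 75)
    and star :: "'a \<Rightarrow> 'a"
  assumes scaleC_add_right: "c *\<^sub>C (x + y) = c *\<^sub>C x + c *\<^sub>C y"
    and scaleC_add_left: "(c + d) *\<^sub>C x = c *\<^sub>C x + d *\<^sub>C x"
    and scaleC_scaleC: "c *\<^sub>C (d *\<^sub>C x) = (c * d) *\<^sub>C x"
    and scaleR_eq_scaleC: "r *\<^sub>R x = complex_of_real r *\<^sub>C x"
    and norm_scaleC: "norm (c *\<^sub>C x) = cmod c * norm x"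
    and mult_scaleC_left: "(c *\<^sub>C x) * y = c *\<^sub>C (x * y)"
    and mult_scaleC_right: "x * (c *\<^sub>C y) = c *\<^sub>C (x * y)"
    and star_add: "star (x + y) = star x + star y"
    and star_scaleC: "star (c *\<^sub>C x) = cnj c *\<^sub>C star x"
    and star_mult: "star (x * y) = star y * star x"
    and star_star: "star (star x) = x"
    and norm_star_mult: "norm (star x * x) = (norm x)\<^sup>2"

text \<open>Boundedness is automatic for *-homomorphisms between C*-algebras.\<close>

definition star_hom :: "('a::cstar_algebra \<Rightarrow> 'b::cstar_algebra) \<Rightarrow> bool" where
  "star_hom f \<longleftrightarrow> bounded_linear f \<and> (\<forall>c x. f (c *\<^sub>C x) = c *\<^sub>C f x) \<and>
     (\<forall>x y. f (x * y) = f x * f y) \<and> (\<forall>x. f (star x) = star (f x)) \<and> f 1 = 1"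

definition complex_subspace :: "'a::cstar_algebra set \<Rightarrow> bool" where
  "complex_subspace D \<longleftrightarrow> 0 \<in> D \<and> (\<forall>x\<in>D. \<forall>y\<in>D. x + y \<in> D) \<and> (\<forall>c. \<forall>x\<in>D. c *\<^sub>C x \<in> D)"

definition cstar_state :: "('a::cstar_algebra \<Rightarrow> complex) \<Rightarrow> bool" where
  "cstar_state \<phi> \<longleftrightarrow> bounded_linear \<phi> \<and> (\<forall>c x. \<phi> (c *\<^sub>C x) = c * \<phi> x) \<and>
     (\<forall>x. \<phi> (star x * x) \<in> \<real> \<and> 0 \<le> Re (\<phi> (star x * x))) \<and> onorm \<phi> = 1"

definition entire :: "(complex \<Rightarrow> 'a::cstar_algebra) \<Rightarrow> bool" where
  "entire F \<longleftrightarrow> (\<forall>z. \<exists>D. ((\<lambda>h. inverse h *\<^sub>C (F (z + h) - F z)) \<longlongrightarrow> D) (at 0))"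

text \<open>\<open>analytic_orbit \<sigma> a F\<close>: the element \<open>a\<close> is \<open>\<sigma>\<close>-analytic and \<open>F z\<close> is \<open>\<sigma>\<^sub>z(a)\<close>.\<close>

definition analytic_orbit ::
    "(real \<Rightarrow> 'a \<Rightarrow> 'a) \<Rightarrow> 'a::cstar_algebra \<Rightarrow> (complex \<Rightarrow> 'a) \<Rightarrow> bool" where
  "analytic_orbit \<sigma> a F \<longleftrightarrow> entire F \<and> (\<forall>t. F (complex_of_real t) = \<sigma> t a)"

text \<open>The dense subspace is \<open>\<sigma>\<close>-invariant, as usual.  Without invariance the condition is
  too weak: on \<open>C(\<T>)\<close> with the rotation action, evaluation at \<open>1\<close> satisfies it for \<open>\<beta> \<noteq> 0\<close> on the dense
  space of those Laurent polynomials \<open>p\<close> that satisfy \<open>p(1) = p(e\<^sup>-\<^sup>\<beta>)\<close>.\<close>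

definition KMS_state ::
    "(real \<Rightarrow> 'a \<Rightarrow> 'a) \<Rightarrow> real \<Rightarrow> ('a::cstar_algebra \<Rightarrow> complex) \<Rightarrow> bool" where
  "KMS_state \<sigma> \<beta> \<phi> \<longleftrightarrow> cstar_state \<phi> \<and>
     (\<exists>D. complex_subspace D \<and> closure D = UNIV \<and> (\<forall>t. \<sigma> t ` D \<subseteq> D) \<and>
        (\<forall>a\<in>D. \<exists>F. analytic_orbit \<sigma> a F \<and>
           (\<forall>b\<in>D. \<phi> (a * b) = \<phi> (b * F (\<i> * complex_of_real \<beta>)))))"


section \<open>The free unital *-algebra on a set of generators\<close>

text \<open>A letter \<open>(s, False)\<close> stands for the generator \<open>s\<close>, and \<open>(s, True)\<close> for its adjoint.\<close>

datatype 's star_word = Word "('s \<times> bool) list"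

instantiation star_word :: (type) monoid_add
begin

definition zero_star_word :: "'s star_word" where
  "zero_star_word = Word []"

fun plus_star_word :: "'s star_word \<Rightarrow> 's star_word \<Rightarrow> 's star_word" where
  "plus_star_word (Word u) (Word v) = Word (u @ v)"

instance
proof
  fix a b c :: "'s star_word"
  show "a + b + c = a + (b + c)" by (cases a; cases b; cases c) simp
  show "0 + a = a" by (cases a) (simp add: zero_star_word_def)
  show "a + 0 = a" by (cases a) (simp add: zero_star_word_def)
qed

end

fun word_star :: "'s star_word \<Rightarrow> 's star_word" where
  "word_star (Word u) = Word (rev (map (\<lambda>(s, b). (s, \<not> b)) u))"

type_synonym 's star_poly = "'s star_word \<Rightarrow>\<^sub>0 complex"

definition poly_gen :: "'s \<Rightarrow> 's star_poly" where
  "poly_gen s = Poly_Mapping.single (Word [(s, False)]) 1"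

definition poly_scale :: "complex \<Rightarrow> 's star_poly \<Rightarrow> 's star_poly" where
  "poly_scale c x = Poly_Mapping.map ((*) c) x"

definition poly_star :: "'s star_poly \<Rightarrow> 's star_poly" where
  "poly_star x =
     (\<Sum>u\<in>Poly_Mapping.keys x. Poly_Mapping.single (word_star u) (cnj (Poly_Mapping.lookup x u)))"

fun word_eval :: "('s \<Rightarrow> 'b::cstar_algebra) \<Rightarrow> 's star_word \<Rightarrow> 'b" where
  "word_eval w (Word u) = prod_list (map (\<lambda>(s, b). if b then star (w s) else w s) u)"

definition poly_eval :: "('s \<Rightarrow> 'b::cstar_algebra) \<Rightarrow> 's star_poly \<Rightarrow> 'b" where
  "poly_eval w x = (\<Sum>u\<in>Poly_Mapping.keys x. Poly_Mapping.lookup x u *\<^sub>C word_eval w u)"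

lemma poly_mapping_sum_single:
  fixes f :: "'k \<Rightarrow>\<^sub>0 'c::comm_monoid_add"
  shows "(\<Sum>k\<in>Poly_Mapping.keys f. Poly_Mapping.single k (Poly_Mapping.lookup f k)) = f"
  by (rule poly_mapping_eqI)
     (auto simp: lookup_sum lookup_single when_def in_keys_iff)

lemma poly_mapping_additive_induct [case_names zero single add]:
  fixes f :: "'k \<Rightarrow>\<^sub>0 'c::comm_monoid_add"
  assumes "P 0" "\<And>k c. P (Poly_Mapping.single k c)" "\<And>x y. P x \<Longrightarrow> P y \<Longrightarrow> P (x + y)"
  shows "P f"
proof -
  have "P (\<Sum>k\<in>A. Poly_Mapping.single k (Poly_Mapping.lookup f k))" if "finite A" for A
    using that by induction (use assms in auto)
  from this[of "Poly_Mapping.keys f"] show ?thesis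
    by (simp add: poly_mapping_sum_single)
qed

lemma poly_scale_conv_mult: "poly_scale c x = Poly_Mapping.single 0 c * x"
  unfolding poly_scale_def by (rule mult_map_scale_conv_mult)

lemma poly_scale_single [simp]:
  "poly_scale c (Poly_Mapping.single u d) = Poly_Mapping.single u (c * d)"
  by (simp add: poly_scale_conv_mult mult_single)

lemma poly_scale_add: "poly_scale c (x + y) = poly_scale c x + poly_scale c y"
  by (simp add: poly_scale_conv_mult distrib_left)

lemma poly_scale_diff: "poly_scale c (x - y) = poly_scale c x - poly_scale c y"
  by (simp add: poly_scale_conv_mult right_diff_distrib)

lemma poly_scale_add_left: "poly_scale (c + d) x = poly_scale c x + poly_scale d x"
  by (simp add: poly_scale_conv_mult distrib_right single_add)

lemma poly_scale_scale: "poly_scale c (poly_scale d x) = poly_scale (c * d) x"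
  by (simp add: poly_scale_conv_mult mult.assoc[symmetric] mult_single)

lemma poly_scale_0 [simp]: "poly_scale 0 x = 0"
  by (simp add: poly_scale_conv_mult)

lemma poly_scale_0_right [simp]: "poly_scale c 0 = 0"
  by (simp add: poly_scale_conv_mult)

lemma poly_scale_1 [simp]: "poly_scale 1 x = x"
  by (simp add: poly_scale_conv_mult)

lemma poly_scale_minus1: "poly_scale (- 1) x = - x"
  by (simp add: poly_scale_conv_mult single_uminus)

lemma poly_scale_mult_left: "poly_scale c x * y = poly_scale c (x * y)"
  by (simp add: poly_scale_conv_mult mult.assoc)

lemma poly_scale_central: "x * Poly_Mapping.single 0 c = Poly_Mapping.single 0 c * x"
  for x :: "'s star_poly"
  by (induction x rule: poly_mapping_additive_induct)
     (simp_all add: mult_single distrib_left distrib_right mult.commute)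

lemma poly_scale_mult_right: "x * poly_scale c y = poly_scale c (x * y)"
  by (simp add: poly_scale_conv_mult mult.assoc[symmetric] poly_scale_central)

lemma poly_star_0 [simp]: "poly_star 0 = 0"
  by (simp add: poly_star_def)

lemma poly_star_single [simp]:
  "poly_star (Poly_Mapping.single u c) = Poly_Mapping.single (word_star u) (cnj c)"
  by (cases "c = 0") (simp_all add: poly_star_def)

lemma poly_star_add: "poly_star (x + y) = poly_star x + poly_star y"
  unfolding poly_star_def
  by (rule setsum_keys_plus_distrib) (simp_all add: single_add)

lemma word_star_word_star [simp]: "word_star (word_star u) = u"
  by (cases u) (auto simp: rev_map[symmetric] map_idI split: prod.splits)

lemma word_star_add: "word_star (u + v) = word_star v + word_star u"
  by (cases u; cases v) simp

lemma word_star_0 [simp]: "word_star 0 = 0"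
  by (simp add: zero_star_word_def)

lemma poly_star_star [simp]: "poly_star (poly_star x) = x"
  by (induction x rule: poly_mapping_additive_induct) (simp_all add: poly_star_add)

lemma poly_star_scale: "poly_star (poly_scale c x) = poly_scale (cnj c) (poly_star x)"
  by (induction x rule: poly_mapping_additive_induct)
     (simp_all add: poly_star_add poly_scale_add)

lemma poly_star_mult: "poly_star (x * y) = poly_star y * poly_star x"
proof (induction x rule: poly_mapping_additive_induct)
  case (single k c)
  show ?case
    by (induction y rule: poly_mapping_additive_induct)
       (simp_all add: poly_star_add mult_single word_star_add mult.commute distrib_left distrib_right)
qed (simp_all add: poly_star_add distrib_left distrib_right)

lemma poly_star_1 [simp]: "poly_star 1 = 1"
  by (simp flip: single_one)

lemma poly_star_minus: "poly_star (- x) = - poly_star x"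
  using poly_star_scale[of "-1" x] by (simp add: poly_scale_minus1)

lemma poly_star_diff: "poly_star (x - y) = poly_star x - poly_star y"
  using poly_star_add[of x "- y"] by (simp add: poly_star_minus)


section \<open>The universal C*-algebra $C^*(S)$\<close>

text \<open>A relation is a pair of *-polynomials in the generators, to be identified.\<close>

inductive_set cstar_relations :: "('s::monoid_mult star_poly \<times> 's star_poly) set" where
  unit: "(poly_gen 1, 1) \<in> cstar_relations"
| mult: "(poly_gen s * poly_gen t, poly_gen (s * t)) \<in> cstar_relations"
| isometry: "(poly_star (poly_gen s) * poly_gen s, 1) \<in> cstar_relations"
| meet: "right_ideal s \<inter> right_ideal t = right_ideal r \<Longrightarrow>
    (poly_gen s * poly_star (poly_gen s) * (poly_gen t * poly_star (poly_gen t)),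
     poly_gen r * poly_star (poly_gen r)) \<in> cstar_relations"
| disjoint: "right_ideal s \<inter> right_ideal t = {} \<Longrightarrow>
    (poly_gen s * poly_star (poly_gen s) * (poly_gen t * poly_star (poly_gen t)), 0)
      \<in> cstar_relations"

definition cstar_seminorm :: "('s star_poly \<Rightarrow> real) \<Rightarrow> bool" where
  "cstar_seminorm p \<longleftrightarrow>
     (\<forall>x y. p (x + y) \<le> p x + p y) \<and> (\<forall>c x. p (poly_scale c x) = cmod c * p x) \<and>
     (\<forall>x y. p (x * y) \<le> p x * p y) \<and> (\<forall>x. p (poly_star x * x) = (p x)\<^sup>2)"

definition admissible_seminorms :: "('s::monoid_mult star_poly \<Rightarrow> real) set" where
  "admissible_seminorms = {p. cstar_seminorm p \<and> (\<forall>(x, y)\<in>cstar_relations. p (x - y) = 0)}"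

definition universal_seminorm :: "'s::monoid_mult star_poly \<Rightarrow> real" where
  "universal_seminorm x = (SUP p\<in>admissible_seminorms. p x)"

lemma cstar_seminormD:
  assumes "cstar_seminorm p"
  shows "p (x + y) \<le> p x + p y" "p (poly_scale c x) = cmod c * p x"
    "p (x * y) \<le> p x * p y" "p (poly_star x * x) = (p x)\<^sup>2"
    "p 0 = 0" "p (- x) = p x" "0 \<le> p x" "p (poly_star x) = p x"
    "p (x - y) \<le> p x + p y" "p (x - y) = p (y - x)" "p x \<le> p y + p (x - y)"
proof -
  note * = assms[unfolded cstar_seminorm_def]
  show tri: "p (x + y) \<le> p x + p y" for x y using * by blast
  show sc: "p (poly_scale c x) = cmod c * p x" for c x using * by blast
  show mu: "p (x * y) \<le> p x * p y" for x y using * by blast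
  show st: "p (poly_star x * x) = (p x)\<^sup>2" for x using * by blast
  show z: "p 0 = 0" using sc[of 0 0] by simp
  show mi: "p (- x) = p x" for x using sc[of "-1" x] by (simp add: poly_scale_minus1)
  show pos: "0 \<le> p x" for x using tri[of x "- x"] by (simp add: mi z)
  have le: "p x \<le> p (poly_star x)" for x
  proof (cases "p x = 0")
    case False
    then have "0 < p x" using pos[of x] by simp
    moreover have "p x * p x \<le> p (poly_star x) * p x"
      using mu[of "poly_star x" x] by (simp add: st power2_eq_square)
    ultimately show ?thesis by simp
  qed (simp add: pos)
  show "p (poly_star x) = p x" using le[of x] le[of "poly_star x"] by simp
  show "p (x - y) \<le> p x + p y" using tri[of x "- y"] by (simp add: mi)
  show "p (x - y) = p (y - x)" using mi[of "x - y"] by simp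
  show "p x \<le> p y + p (x - y)" using tri[of y "x - y"] by simp
qed

lemma zero_admissible: "(\<lambda>_. 0) \<in> admissible_seminorms"
  by (auto simp: admissible_seminorms_def cstar_seminorm_def)

lemma admissible_bound:
  assumes "p \<in> admissible_seminorms"
  shows "p x \<le> (\<Sum>u\<in>Poly_Mapping.keys x. cmod (Poly_Mapping.lookup x u))"
proof -
  have p: "cstar_seminorm p" and rel: "\<And>x y. (x, y) \<in> cstar_relations \<Longrightarrow> p (x - y) = 0"
    using assms by (auto simp: admissible_seminorms_def)
  note pD = cstar_seminormD[OF p]
  have "p 1 = p 1 * p 1" using pD(4)[of 1] by (simp add: power2_eq_square)
  then have p1: "p 1 \<le> 1" by (cases "p 1 = 0") auto
  have gen: "p (poly_gen s) \<le> 1" for s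
  proof -
    have "p (poly_star (poly_gen s) * poly_gen s) \<le> p 1 + p (poly_star (poly_gen s) * poly_gen s - 1)"
      by (rule pD(11))
    also have "\<dots> \<le> 1" using p1 by (simp add: rel cstar_relations.isometry)
    finally show ?thesis using pD(7)[of "poly_gen s"] by (simp add: pD(4) power_le_one_iff abs_square_le_1)
  qed
  have letter: "p (Poly_Mapping.single (Word [(s, b)]) 1) \<le> 1" for s b
    using gen[of s] pD(8)[of "poly_gen s"] by (cases b) (simp_all add: poly_gen_def)
  have word: "p (Poly_Mapping.single (Word l) 1) \<le> 1" for l
  proof (induction l)
    case Nil
    then show ?case using p1 by (simp flip: zero_star_word_def)
  next
    case (Cons a l)
    have "Poly_Mapping.single (Word (a # l)) 1 =
        Poly_Mapping.single (Word [a]) 1 * Poly_Mapping.single (Word l) (1::complex)"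
      by (simp add: mult_single)
    then have "p (Poly_Mapping.single (Word (a # l)) 1)
        \<le> p (Poly_Mapping.single (Word [a]) 1) * p (Poly_Mapping.single (Word l) 1)"
      using pD(3) by metis
    also have "\<dots> \<le> 1 * 1"
      using letter[of "fst a" "snd a"] Cons by (intro mult_mono) (auto simp: pD(7))
    finally show ?case by simp
  qed
  have single: "p (Poly_Mapping.single u c) \<le> cmod c" for u c
  proof -
    have "p (Poly_Mapping.single u c) = cmod c * p (Poly_Mapping.single u 1)"
      using pD(2)[of c "Poly_Mapping.single u 1"] by simp
    also have "\<dots> \<le> cmod c * 1" by (cases u) (simp only:, intro mult_left_mono word norm_ge_zero)
    finally show ?thesis by simp
  qed
  have "p (\<Sum>u\<in>A. Poly_Mapping.single u (Poly_Mapping.lookup x u))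
      \<le> (\<Sum>u\<in>A. cmod (Poly_Mapping.lookup x u))" if "finite A" for A
    using that
  proof induction
    case (insert a A)
    then show ?case
      using pD(1) single by simp (meson add_mono order_trans)
  qed (simp add: pD(5))
  from this[of "Poly_Mapping.keys x"] show ?thesis
    by (simp add: poly_mapping_sum_single)
qed

lemma admissible_le_universal:
  assumes "p \<in> admissible_seminorms"
  shows "p x \<le> universal_seminorm x"
  unfolding universal_seminorm_def
  by (rule cSUP_upper[OF assms], rule bdd_aboveI2, rule admissible_bound)

lemma universal_least:
  assumes "\<And>p. p \<in> admissible_seminorms \<Longrightarrow> p x \<le> c"
  shows "universal_seminorm x \<le> c"
  unfolding universal_seminorm_def
  by (rule cSUP_least) (use zero_admissible assms in auto)

lemma universal_admissible: "universal_seminorm \<in> admissible_seminorms"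
proof -
  let ?u = "universal_seminorm :: 'a star_poly \<Rightarrow> real"
  note le = admissible_le_universal
  have D: "cstar_seminorm p" if "p \<in> admissible_seminorms" for p :: "'a star_poly \<Rightarrow> real"
    using that by (simp add: admissible_seminorms_def)
  have pos: "0 \<le> ?u x" for x using le[OF zero_admissible] .
  have scale: "?u (poly_scale c x) \<le> cmod c * ?u x" for c x
    by (rule universal_least) (simp add: cstar_seminormD[OF D] mult_left_mono le)
  have "?u (x + y) \<le> ?u x + ?u y" for x y
    by (rule universal_least) (meson cstar_seminormD(1)[OF D] add_mono le order_trans)
  moreover have "?u (x * y) \<le> ?u x * ?u y" for x y
    by (rule universal_least)
      (meson cstar_seminormD(3,7)[OF D] mult_mono le order_trans pos)
  moreover have "?u (poly_scale c x) = cmod c * ?u x" for c x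
  proof (cases "c = 0")
    case True
    then show ?thesis using scale[of c x] pos[of "poly_scale c x"] by simp
  next
    case False
    have "?u x \<le> cmod (inverse c) * ?u (poly_scale c x)"
      using scale[of "inverse c" "poly_scale c x"] False by (simp add: poly_scale_scale)
    then have "cmod c * ?u x \<le> ?u (poly_scale c x)"
      using False by (simp add: norm_inverse pos_le_divide_eq mult.commute flip: divide_inverse divide_inverse_commute)
    then show ?thesis using scale[of c x] by simp
  qed
  moreover have "?u (poly_star x * x) = (?u x)\<^sup>2" for x
  proof (rule antisym)
    show "?u (poly_star x * x) \<le> (?u x)\<^sup>2"
      by (rule universal_least) (simp add: cstar_seminormD[OF D] power_mono le)
    have "?u x \<le> sqrt (?u (poly_star x * x))"
      by (rule universal_least) (metis cstar_seminormD(4)[OF D] le real_le_rsqrt)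
    then show "(?u x)\<^sup>2 \<le> ?u (poly_star x * x)"
      using pos by (metis real_sqrt_pow2 power_mono)
  qed
  moreover have "?u (x - y) = 0" if "(x, y) \<in> cstar_relations" for x y
  proof -
    have "?u (x - y) \<le> 0"
      by (rule universal_least) (use that in \<open>auto simp: admissible_seminorms_def\<close>)
    then show ?thesis using pos[of "x - y"] by simp
  qed
  ultimately show ?thesis
    by (auto simp: admissible_seminorms_def cstar_seminorm_def)
qed

lemma universal_cstar_seminorm: "cstar_seminorm universal_seminorm"
  using universal_admissible unfolding admissible_seminorms_def by blast

lemma universal_relation: "(x, y) \<in> cstar_relations \<Longrightarrow> universal_seminorm (x - y) = 0"
  using universal_admissible by (auto simp: admissible_seminorms_def)

lemmas universalD = cstar_seminormD[OF universal_cstar_seminorm]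

text \<open>$C^*(S)$ is the completion of the free *-algebra with respect to
  the largest C*-seminorm compatible with the relations.\<close>

definition poly_null :: "(nat \<Rightarrow> 's::monoid_mult star_poly) \<Rightarrow> bool" where
  "poly_null X \<longleftrightarrow> (\<lambda>n. universal_seminorm (X n)) \<longlonglongrightarrow> 0"

definition poly_cauchy :: "(nat \<Rightarrow> 's::monoid_mult star_poly) \<Rightarrow> bool" where
  "poly_cauchy X \<longleftrightarrow> (\<forall>e>0. \<exists>M. \<forall>m\<ge>M. \<forall>n\<ge>M. universal_seminorm (X m - X n) < e)"

definition cstar_rel where
  "cstar_rel X Y \<longleftrightarrow> poly_cauchy X \<and> poly_cauchy Y \<and> poly_null (\<lambda>n. X n - Y n)"

lemma poly_null_le:
  assumes "poly_null Y" "\<And>n. universal_seminorm (X n) \<le> c * universal_seminorm (Y n)"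
  shows "poly_null X"
  unfolding poly_null_def
proof (rule tendsto_sandwich[OF _ _ tendsto_const])
  show "(\<lambda>n. c * universal_seminorm (Y n)) \<longlonglongrightarrow> 0"
    using tendsto_mult_right_zero assms(1) unfolding poly_null_def by blast
qed (auto simp: assms universalD)

lemma poly_null_0 [simp]: "poly_null (\<lambda>n. 0)"
  by (simp add: poly_null_def universalD)

lemma poly_null_add: "poly_null X \<Longrightarrow> poly_null Y \<Longrightarrow> poly_null (\<lambda>n. X n + Y n)"
  unfolding poly_null_def
  by (rule tendsto_sandwich[OF _ _ tendsto_const
        tendsto_add_zero[of "\<lambda>n. universal_seminorm (X n)" _ "\<lambda>n. universal_seminorm (Y n)"]])
     (auto simp: universalD)

lemma poly_null_sym: "poly_null (\<lambda>n. X n - Y n) \<Longrightarrow> poly_null (\<lambda>n. Y n - X n)"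
  by (erule poly_null_le[of _ _ 1]) (simp add: universalD(10))

lemma poly_cauchy_const [simp]: "poly_cauchy (\<lambda>n. x)"
  by (simp add: poly_cauchy_def universalD)

lemma poly_cauchy_add:
  assumes "poly_cauchy X" "poly_cauchy Y"
  shows "poly_cauchy (\<lambda>n. X n + Y n)"
  unfolding poly_cauchy_def
proof (intro allI impI)
  fix e :: real assume "0 < e"
  then have "0 < e / 2" by simp
  then obtain M1 M2 where M: "\<forall>m\<ge>M1. \<forall>n\<ge>M1. universal_seminorm (X m - X n) < e / 2"
      "\<forall>m\<ge>M2. \<forall>n\<ge>M2. universal_seminorm (Y m - Y n) < e / 2"
    using assms unfolding poly_cauchy_def by meson
  have "universal_seminorm (X m + Y m - (X n + Y n)) < e" if "max M1 M2 \<le> m" "max M1 M2 \<le> n" for m n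
  proof -
    have "universal_seminorm (X m - X n) < e / 2" "universal_seminorm (Y m - Y n) < e / 2"
      using M that by auto
    then show ?thesis
      using universalD(1)[of "X m - X n" "Y m - Y n"] by (simp add: algebra_simps)
  qed
  then show "\<exists>M. \<forall>m\<ge>M. \<forall>n\<ge>M. universal_seminorm (X m + Y m - (X n + Y n)) < e" by blast
qed

lemma poly_cauchy_le:
  assumes "poly_cauchy X" "0 \<le> c"
    and "\<And>m n. universal_seminorm (Y m - Y n) \<le> c * universal_seminorm (X m - X n)"
  shows "poly_cauchy Y"
  unfolding poly_cauchy_def
proof (intro allI impI)
  fix e :: real assume "0 < e"
  then have "0 < e / (c + 1)" using assms(2) by simp
  then obtain M where M: "\<And>m n. m \<ge> M \<Longrightarrow> n \<ge> M \<Longrightarrow> universal_seminorm (X m - X n) < e / (c + 1)"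
    using assms(1) unfolding poly_cauchy_def by meson
  have "universal_seminorm (Y m - Y n) < e" if "M \<le> m" "M \<le> n" for m n
  proof -
    have "universal_seminorm (Y m - Y n) \<le> (c + 1) * universal_seminorm (X m - X n)"
      using assms(3)[of m n] universalD(7)[of "X m - X n"] by (simp add: distrib_right)
    also have "\<dots> < (c + 1) * (e / (c + 1))"
      using M[OF that] assms(2) by (intro mult_strict_left_mono) auto
    finally show ?thesis using assms(2) by simp
  qed
  then show "\<exists>M. \<forall>m\<ge>M. \<forall>n\<ge>M. universal_seminorm (Y m - Y n) < e" by blast
qed

lemma poly_cauchy_convergent:
  assumes "poly_cauchy X"
  shows "convergent (\<lambda>n. universal_seminorm (X n))"
proof -
  have "\<bar>universal_seminorm x - universal_seminorm y\<bar> \<le> universal_seminorm (x - y)"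
    for x y :: "'a star_poly"
    using universalD(11)[of x y] universalD(11)[of y x] universalD(10)[of x y] by simp
  then have "Cauchy (\<lambda>n. universal_seminorm (X n))"
    using assms unfolding poly_cauchy_def Cauchy_def dist_real_def by (meson le_less_trans)
  then show ?thesis by (simp add: Cauchy_convergent_iff)
qed

lemma poly_cauchy_bounded:
  assumes "poly_cauchy X"
  obtains B where "0 \<le> B" "\<And>n. universal_seminorm (X n) \<le> B"
proof -
  have "Bseq (\<lambda>n. universal_seminorm (X n))"
    using assms by (intro convergent_imp_Bseq poly_cauchy_convergent)
  then obtain B where "0 < B" "\<forall>n. norm (universal_seminorm (X n)) \<le> B"
    unfolding Bseq_def by blast
  then show ?thesis using that[of B] by (auto simp: abs_le_iff)
qed

lemma poly_cauchy_mult: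
  assumes X: "poly_cauchy X" and Y: "poly_cauchy Y"
  shows "poly_cauchy (\<lambda>n. X n * Y n)"
proof -
  obtain A B where A: "0 \<le> A" "\<And>n. universal_seminorm (X n) \<le> A"
      and B: "0 \<le> B" "\<And>n. universal_seminorm (Y n) \<le> B"
    using poly_cauchy_bounded[OF X] poly_cauchy_bounded[OF Y] by metis
  show ?thesis
    unfolding poly_cauchy_def
  proof (intro allI impI)
    fix e :: real assume "0 < e"
    then have "0 < e / (A + B + 1)" using A B by simp
    then obtain M1 M2 where
        M: "\<forall>m\<ge>M1. \<forall>n\<ge>M1. universal_seminorm (X m - X n) < e / (A + B + 1)"
        "\<forall>m\<ge>M2. \<forall>n\<ge>M2. universal_seminorm (Y m - Y n) < e / (A + B + 1)"
      using X Y unfolding poly_cauchy_def by meson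
    have "universal_seminorm (X m * Y m - X n * Y n) < e"
      if "max M1 M2 \<le> m" "max M1 M2 \<le> n" for m n
    proof -
      have M': "universal_seminorm (X m - X n) \<le> e / (A + B + 1)"
        "universal_seminorm (Y m - Y n) \<le> e / (A + B + 1)"
        using M that by (auto intro: less_imp_le)
      have "universal_seminorm (X m * Y m - X n * Y n)
          = universal_seminorm (X m * (Y m - Y n) + (X m - X n) * Y n)"
        by (simp add: algebra_simps)
      also have "\<dots> \<le> universal_seminorm (X m) * universal_seminorm (Y m - Y n)
          + universal_seminorm (X m - X n) * universal_seminorm (Y n)"
        by (meson universalD(1,3) add_mono order_trans)
      also have "\<dots> \<le> A * (e / (A + B + 1)) + e / (A + B + 1) * B"
        using A B M' \<open>0 < e\<close> by (intro add_mono mult_mono) (auto simp: universalD)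
      also have "\<dots> = e * ((A + B) / (A + B + 1))" by (simp add: add_divide_distrib algebra_simps)
      also have "\<dots> < e * 1" using A B \<open>0 < e\<close> by (intro mult_strict_left_mono) auto
      also have "\<dots> = e" by simp
      finally show ?thesis .
    qed
    then show "\<exists>M. \<forall>m\<ge>M. \<forall>n\<ge>M. universal_seminorm (X m * Y m - X n * Y n) < e" by blast
  qed
qed

lemma poly_null_mult_left:
  assumes "poly_cauchy X" "poly_null Y"
  shows "poly_null (\<lambda>n. X n * Y n)"
proof -
  obtain A where A: "0 \<le> A" "\<And>n. universal_seminorm (X n) \<le> A"
    using poly_cauchy_bounded[OF assms(1)] by blast
  have "universal_seminorm (X n * Y n) \<le> A * universal_seminorm (Y n)" for n
    by (meson universalD(3,7) A mult_right_mono order_trans)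
  then show ?thesis using assms(2) by (rule poly_null_le[rotated])
qed

lemma poly_null_mult_right:
  assumes "poly_null X" "poly_cauchy Y"
  shows "poly_null (\<lambda>n. X n * Y n)"
proof -
  obtain A where A: "0 \<le> A" "\<And>n. universal_seminorm (Y n) \<le> A"
    using poly_cauchy_bounded[OF assms(2)] by blast
  have "universal_seminorm (X n * Y n) \<le> A * universal_seminorm (X n)" for n
    using universalD(3)[of "X n" "Y n"] mult_left_mono[OF A(2)[of n] universalD(7)[of "X n"]]
    by (simp add: mult.commute)
  then show ?thesis using assms(1) by (rule poly_null_le[rotated])
qed

lemma poly_cauchy_scale: "poly_cauchy X \<Longrightarrow> poly_cauchy (\<lambda>n. poly_scale c (X n))"
  by (rule poly_cauchy_le[of X "cmod c"])
     (simp_all add: poly_scale_diff[symmetric] universalD(2))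

lemma poly_cauchy_star: "poly_cauchy X \<Longrightarrow> poly_cauchy (\<lambda>n. poly_star (X n))"
  by (rule poly_cauchy_le[of X 1]) (simp_all add: poly_star_diff[symmetric] universalD(8))

lemma poly_cauchy_minus: "poly_cauchy X \<Longrightarrow> poly_cauchy (\<lambda>n. - X n)"
  using poly_cauchy_scale[of X "-1"] by (simp add: poly_scale_minus1)

lemma cstar_rel_refl: "cstar_rel X X \<longleftrightarrow> poly_cauchy X"
  by (simp add: cstar_rel_def)

lemma cstar_rel_trans: "cstar_rel X Y \<Longrightarrow> cstar_rel Y Z \<Longrightarrow> cstar_rel X Z"
  using poly_null_add[of "\<lambda>n. X n - Y n" "\<lambda>n. Y n - Z n"] by (simp add: cstar_rel_def)

lemma cstar_rel_sym: "cstar_rel X Y \<Longrightarrow> cstar_rel Y X"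
  by (simp add: cstar_rel_def poly_null_sym)

lemma part_equivp_cstar_rel: "part_equivp cstar_rel"
  by (rule part_equivpI)
     (use cstar_rel_refl poly_cauchy_const in blast,
      blast intro: sympI cstar_rel_sym, blast intro: transpI cstar_rel_trans)

quotient_type (overloaded) 's cstar = "nat \<Rightarrow> 's::monoid_mult star_poly" / partial: cstar_rel
  by (rule part_equivp_cstar_rel)


lemma Domainp_cr_cstar [transfer_domain_rule]: "Domainp cr_cstar = poly_cauchy"
  by (simp add: cstar.domain cstar_rel_refl fun_eq_iff)

lemma cstar_rel_cong:
  assumes "poly_cauchy X" "poly_cauchy Y" "\<And>n. X n = Y n"
  shows "cstar_rel X Y"
  using assms by (simp add: cstar_rel_def)

lemma poly_norm_diff_le:
  "\<bar>universal_seminorm x - universal_seminorm y\<bar> \<le> universal_seminorm (x - y)"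
  using universalD(11)[of x y] universalD(11)[of y x] universalD(10)[of x y] by simp

lemma poly_norm_lim:
  "poly_cauchy X \<Longrightarrow> (\<lambda>n. universal_seminorm (X n)) \<longlonglongrightarrow> lim (\<lambda>n. universal_seminorm (X n))"
  using poly_cauchy_convergent[of X] by (simp only: convergent_LIMSEQ_iff)

lemma poly_norm_rel:
  assumes "cstar_rel X Y"
  shows "lim (\<lambda>n. universal_seminorm (X n)) = lim (\<lambda>n. universal_seminorm (Y n))"
proof -
  have XY: "poly_cauchy X" "poly_cauchy Y" "(\<lambda>n. universal_seminorm (X n - Y n)) \<longlonglongrightarrow> 0"
    using assms by (simp_all add: cstar_rel_def poly_null_def)
  have "(\<lambda>n. universal_seminorm (X n) - universal_seminorm (Y n)) \<longlonglongrightarrow> 0"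
    by (rule Lim_null_comparison[OF _ XY(3)]) (simp add: poly_norm_diff_le)
  from LIMSEQ_unique[OF tendsto_diff[OF poly_norm_lim[OF XY(1)] poly_norm_lim[OF XY(2)]] this]
  show ?thesis by simp
qed

lemma cstar_rel_scale:
  assumes "cstar_rel X X'"
  shows "cstar_rel (\<lambda>n. poly_scale c (X n)) (\<lambda>n. poly_scale c (X' n))"
  using assms
    poly_null_le[of "\<lambda>n. X n - X' n" "\<lambda>n. poly_scale c (X n) - poly_scale c (X' n)" "cmod c"]
  by (simp add: cstar_rel_def poly_cauchy_scale poly_scale_diff[symmetric] universalD(2))

lift_definition cstar_scale :: "complex \<Rightarrow> 's cstar \<Rightarrow> 's::monoid_mult cstar"
  is "\<lambda>c X n. poly_scale c (X n)"
  by (rule cstar_rel_scale)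

instantiation cstar :: (monoid_mult) "{real_normed_algebra, monoid_mult}"
begin

lift_definition zero_cstar :: "'a cstar" is "\<lambda>n. 0"
  by (simp add: cstar_rel_refl)

lift_definition one_cstar :: "'a cstar" is "\<lambda>n. 1"
  by (simp add: cstar_rel_refl)

lift_definition plus_cstar :: "'a cstar \<Rightarrow> 'a cstar \<Rightarrow> 'a cstar" is "\<lambda>X Y n. X n + Y n"
proof -
  fix X X' Y Y' :: "nat \<Rightarrow> 'a star_poly"
  assume "cstar_rel X X'" "cstar_rel Y Y'"
  then show "cstar_rel (\<lambda>n. X n + Y n) (\<lambda>n. X' n + Y' n)"
    using poly_null_add[of "\<lambda>n. X n - X' n" "\<lambda>n. Y n - Y' n"]
    by (simp add: cstar_rel_def poly_cauchy_add algebra_simps)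
qed

lift_definition uminus_cstar :: "'a cstar \<Rightarrow> 'a cstar" is "\<lambda>X n. - X n"
proof -
  fix X X' :: "nat \<Rightarrow> 'a star_poly"
  assume "cstar_rel X X'"
  then show "cstar_rel (\<lambda>n. - X n) (\<lambda>n. - X' n)"
    using poly_null_sym[of X X'] by (simp add: cstar_rel_def poly_cauchy_minus)
qed

lift_definition times_cstar :: "'a cstar \<Rightarrow> 'a cstar \<Rightarrow> 'a cstar" is "\<lambda>X Y n. X n * Y n"
proof -
  fix X X' Y Y' :: "nat \<Rightarrow> 'a star_poly"
  assume *: "cstar_rel X X'" "cstar_rel Y Y'"
  then have "poly_null (\<lambda>n. (X n - X' n) * Y n + X' n * (Y n - Y' n))"
    by (intro poly_null_add poly_null_mult_left poly_null_mult_right) (auto simp: cstar_rel_def)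
  then show "cstar_rel (\<lambda>n. X n * Y n) (\<lambda>n. X' n * Y' n)"
    using * by (simp add: cstar_rel_def poly_cauchy_mult algebra_simps)
qed

lift_definition norm_cstar :: "'a cstar \<Rightarrow> real" is "\<lambda>X. lim (\<lambda>n. universal_seminorm (X n))"
  by (rule poly_norm_rel)

definition minus_cstar :: "'a cstar \<Rightarrow> 'a cstar \<Rightarrow> 'a cstar" where
  "minus_cstar x y = x + - y"

definition scaleR_cstar :: "real \<Rightarrow> 'a cstar \<Rightarrow> 'a cstar" where
  "scaleR_cstar r x = cstar_scale (complex_of_real r) x"

definition sgn_cstar :: "'a cstar \<Rightarrow> 'a cstar" where
  "sgn_cstar x = scaleR (inverse (norm x)) x"

definition dist_cstar :: "'a cstar \<Rightarrow> 'a cstar \<Rightarrow> real" where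
  "dist_cstar x y = norm (x - y)"

definition uniformity_cstar :: "('a cstar \<times> 'a cstar) filter" where
  "uniformity_cstar = (INF e\<in>{0<..}. principal {(x, y). dist x y < e})"

definition open_cstar :: "'a cstar set \<Rightarrow> bool" where
  "open_cstar U \<longleftrightarrow> (\<forall>x\<in>U. eventually (\<lambda>(x', y). x' = x \<longrightarrow> y \<in> U) uniformity)"

instance
proof
  fix x y z :: "'a cstar" and c d :: complex and r r' :: real
  show "x + y + z = x + (y + z)"
    by transfer (simp add: cstar_rel_def poly_cauchy_add ac_simps)
  show "x + y = y + x"
    by transfer (simp add: cstar_rel_def poly_cauchy_add ac_simps)
  show "0 + x = x"
    by transfer (simp add: cstar_rel_def)
  show "- x + x = 0"
    by transfer (simp add: cstar_rel_def)
  show "x - y = x + - y"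
    by (rule minus_cstar_def)
  show "x * y * z = x * (y * z)"
    by transfer (simp add: cstar_rel_def poly_cauchy_mult mult.assoc)
  show "1 * x = x" "x * 1 = x"
    by (transfer, simp add: cstar_rel_def)+
  show "(x + y) * z = x * z + y * z" "x * (y + z) = x * y + x * z"
    by (transfer, simp add: cstar_rel_def poly_cauchy_mult poly_cauchy_add
        distrib_left distrib_right)+
  have aR: "cstar_scale c (x + y) = cstar_scale c x + cstar_scale c y" for c :: complex and x y :: "'a cstar"
    by transfer (simp add: cstar_rel_def poly_cauchy_scale poly_cauchy_add poly_scale_add)
  have aL: "cstar_scale (c + d) x = cstar_scale c x + cstar_scale d x" for c d :: complex and x :: "'a cstar"
    by transfer (simp add: cstar_rel_def poly_cauchy_scale poly_cauchy_add poly_scale_add_left)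
  have sc: "cstar_scale c (cstar_scale d x) = cstar_scale (c * d) x" for c d :: complex and x :: "'a cstar"
    by transfer (simp add: cstar_rel_def poly_cauchy_scale poly_scale_scale)
  have mL: "cstar_scale c x * y = cstar_scale c (x * y)" for c :: complex and x y :: "'a cstar"
    by transfer (simp add: cstar_rel_def poly_cauchy_scale poly_cauchy_mult poly_scale_mult_left)
  have mR: "x * cstar_scale c y = cstar_scale c (x * y)" for c :: complex and x y :: "'a cstar"
    by transfer (simp add: cstar_rel_def poly_cauchy_scale poly_cauchy_mult poly_scale_mult_right)
  have nC: "norm (cstar_scale c x) = cmod c * norm x" for c :: complex and x :: "'a cstar"
  proof transfer
    fix c :: complex and X :: "nat \<Rightarrow> 'a star_poly" assume "poly_cauchy X"
    then show "lim (\<lambda>n. universal_seminorm (poly_scale c (X n))) = cmod c * lim (\<lambda>n. universal_seminorm (X n))"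
      unfolding universalD(2) by (intro limI tendsto_mult_left poly_norm_lim)
  qed
  have one: "cstar_scale 1 x = x" for x :: "'a cstar"
    by transfer (simp add: cstar_rel_def)
  show "r *\<^sub>R (x + y) = r *\<^sub>R x + r *\<^sub>R y" "(r + r') *\<^sub>R x = r *\<^sub>R x + r' *\<^sub>R x"
    "r *\<^sub>R r' *\<^sub>R x = (r * r') *\<^sub>R x" "1 *\<^sub>R x = x"
    "r *\<^sub>R x * y = r *\<^sub>R (x * y)" "x * r *\<^sub>R y = r *\<^sub>R (x * y)"
    "norm (r *\<^sub>R x) = \<bar>r\<bar> * norm x"
    by (simp_all add: scaleR_cstar_def aR aL sc one mL mR nC)
  show "sgn x = scaleR (inverse (norm x)) x"
    by (rule sgn_cstar_def)
  show "dist x y = norm (x - y)"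
    by (rule dist_cstar_def)
  show "uniformity = (INF e\<in>{0<..}. principal {(x :: 'a cstar, y). dist x y < e})"
    by (rule uniformity_cstar_def)
  show "open U \<longleftrightarrow> (\<forall>x\<in>U. \<forall>\<^sub>F (x', y) in uniformity. x' = x \<longrightarrow> y \<in> U)" for U :: "'a cstar set"
    by (rule open_cstar_def)
  show "norm x = 0 \<longleftrightarrow> x = 0"
  proof transfer
    fix X :: "nat \<Rightarrow> 'a star_poly" assume X: "poly_cauchy X"
    show "lim (\<lambda>n. universal_seminorm (X n)) = 0 \<longleftrightarrow> cstar_rel X (\<lambda>n. 0)"
      using X poly_norm_lim[OF X] limI[of "\<lambda>n. universal_seminorm (X n)" 0]
      by (auto simp add: cstar_rel_def poly_null_def)
  qed
  show "norm (x + y) \<le> norm x + norm y"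
  proof transfer
    fix X Y :: "nat \<Rightarrow> 'a star_poly" assume "poly_cauchy X" "poly_cauchy Y"
    then show "lim (\<lambda>n. universal_seminorm (X n + Y n))
        \<le> lim (\<lambda>n. universal_seminorm (X n)) + lim (\<lambda>n. universal_seminorm (Y n))"
      by (intro LIMSEQ_le[OF poly_norm_lim tendsto_add[OF poly_norm_lim poly_norm_lim]])
         (simp_all add: universalD(1,3) poly_cauchy_add)
  qed
  show "norm (x * y) \<le> norm x * norm y"
  proof transfer
    fix X Y :: "nat \<Rightarrow> 'a star_poly" assume "poly_cauchy X" "poly_cauchy Y"
    then show "lim (\<lambda>n. universal_seminorm (X n * Y n))
        \<le> lim (\<lambda>n. universal_seminorm (X n)) * lim (\<lambda>n. universal_seminorm (Y n))"
      by (intro LIMSEQ_le[OF poly_norm_lim tendsto_mult[OF poly_norm_lim poly_norm_lim]])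
         (simp_all add: universalD(1,3) poly_cauchy_mult)
  qed
qed

end

definition cstar_of_poly :: "'s::monoid_mult star_poly \<Rightarrow> 's cstar" where
  "cstar_of_poly x = abs_cstar (\<lambda>n. x)"

lemma norm_cstar_of_poly: "norm (cstar_of_poly x) = universal_seminorm x"
  by (simp add: cstar_of_poly_def norm_cstar.abs_eq cstar_rel_refl)

lemma cstar_of_poly_diff: "cstar_of_poly (x - y) = cstar_of_poly x - cstar_of_poly y"
proof -
  have "cstar_of_poly (x - y) + cstar_of_poly y = cstar_of_poly x"
    by (simp add: cstar_of_poly_def plus_cstar.abs_eq cstar_rel_refl)
  then show ?thesis by (simp add: eq_diff_eq)
qed

lemma poly_cauchy_limit:
  assumes "poly_cauchy X"
  shows "(\<lambda>n. cstar_of_poly (X n)) \<longlonglongrightarrow> abs_cstar X"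
proof (rule LIMSEQ_I)
  fix e :: real assume "0 < e"
  then obtain M where M: "\<And>m n. m \<ge> M \<Longrightarrow> n \<ge> M \<Longrightarrow> universal_seminorm (X m - X n) < e / 2"
    using assms unfolding poly_cauchy_def by (meson half_gt_zero)
  have "norm (cstar_of_poly (X n) - abs_cstar X) < e" if "M \<le> n" for n
  proof -
    have c: "poly_cauchy (\<lambda>m. X n - X m)"
      using poly_cauchy_add[OF poly_cauchy_const poly_cauchy_minus[OF assms], of "X n"] by simp
    have "cstar_of_poly (X n) = abs_cstar (\<lambda>m. X n)"
      by (rule cstar_of_poly_def)
    also have "\<dots> = abs_cstar (\<lambda>m. X n - X m) + abs_cstar X"
      using assms c by (simp add: plus_cstar.abs_eq cstar_rel_refl)
    finally have "norm (cstar_of_poly (X n) - abs_cstar X)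
        = lim (\<lambda>m. universal_seminorm (X n - X m))"
      using c by (simp add: norm_cstar.abs_eq cstar_rel_refl)
    also have "\<dots> \<le> e / 2"
      by (rule LIMSEQ_le_const2[OF poly_norm_lim[OF c]]) (meson M that less_imp_le)
    also have "\<dots> < e" using \<open>0 < e\<close> by simp
    finally show ?thesis .
  qed
  then show "\<exists>M. \<forall>n\<ge>M. norm (cstar_of_poly (X n) - abs_cstar X) < e" by blast
qed

lemma cstar_cases:
  obtains X where "poly_cauchy X" "x = abs_cstar X"
  by (metis Quotient3_cstar Quotient3_abs_rep Quotient3_rep_reflp cstar_rel_refl)

lemma cstar_dense:
  assumes "0 < e"
  obtains p where "norm (cstar_of_poly p - x) < e"
proof -
  obtain X where "poly_cauchy X" "x = abs_cstar X" by (rule cstar_cases)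
  then have "(\<lambda>n. cstar_of_poly (X n)) \<longlonglongrightarrow> x" using poly_cauchy_limit by blast
  from LIMSEQ_D[OF this assms] show ?thesis using that by blast
qed

instance cstar :: (monoid_mult) banach
proof
  fix x :: "nat \<Rightarrow> 'a cstar" assume x: "Cauchy x"
  have "\<exists>p. norm (cstar_of_poly p - x n) < inverse (real (Suc n))" for n
    using cstar_dense[of "inverse (real (Suc n))" "x n"] by (metis inverse_positive_iff_positive of_nat_0_less_iff zero_less_Suc)
  then obtain p where p: "\<And>n. norm (cstar_of_poly (p n) - x n) < inverse (real (Suc n))"
    by metis
  have near: "(\<lambda>n. cstar_of_poly (p n) - x n) \<longlonglongrightarrow> 0"
    by (rule Lim_null_comparison[OF _ LIMSEQ_inverse_real_of_nat])
       (intro always_eventually allI less_imp_le[OF p])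
  have "poly_cauchy p"
    unfolding poly_cauchy_def
  proof (intro allI impI)
    fix e :: real assume "0 < e"
    then have e: "0 < e / 3" by simp
    obtain M1 where M1: "\<And>n. n \<ge> M1 \<Longrightarrow> norm (cstar_of_poly (p n) - x n - 0) < e / 3"
      using LIMSEQ_D[OF near e] by blast
    obtain M2 where M2: "\<And>m n. m \<ge> M2 \<Longrightarrow> n \<ge> M2 \<Longrightarrow> norm (x m - x n) < e / 3"
      using x e unfolding Cauchy_iff by meson
    have "universal_seminorm (p m - p n) < e" if "max M1 M2 \<le> m" "max M1 M2 \<le> n" for m n
    proof -
      have "norm (cstar_of_poly (p m) - x m) < e / 3" "norm (cstar_of_poly (p n) - x n) < e / 3"
        "norm (x m - x n) < e / 3"
        using M1[of m] M1[of n] M2[of m n] that by auto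
      then have "norm ((cstar_of_poly (p m) - x m) - (cstar_of_poly (p n) - x n) + (x m - x n)) < e"
        using norm_triangle_ineq[of "(cstar_of_poly (p m) - x m) - (cstar_of_poly (p n) - x n)" "x m - x n"]
          norm_triangle_ineq4[of "cstar_of_poly (p m) - x m" "cstar_of_poly (p n) - x n"] by linarith
      then show ?thesis
        by (simp add: norm_cstar_of_poly flip: cstar_of_poly_diff)
    qed
    then show "\<exists>M. \<forall>m\<ge>M. \<forall>n\<ge>M. universal_seminorm (p m - p n) < e" by blast
  qed
  from tendsto_diff[OF poly_cauchy_limit[OF this] near] show "convergent x"
    by (auto simp: convergent_def)
qed

instantiation cstar :: (monoid_mult) cstar_algebra
begin

definition scaleC_cstar :: "complex \<Rightarrow> 'a cstar \<Rightarrow> 'a cstar" where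
  "scaleC_cstar = cstar_scale"

lift_definition star_cstar :: "'a cstar \<Rightarrow> 'a cstar" is "\<lambda>X n. poly_star (X n)"
proof -
  fix X X' :: "nat \<Rightarrow> 'a star_poly"
  assume "cstar_rel X X'"
  then show "cstar_rel (\<lambda>n. poly_star (X n)) (\<lambda>n. poly_star (X' n))"
    using poly_null_le[of "\<lambda>n. X n - X' n" "\<lambda>n. poly_star (X n) - poly_star (X' n)" 1]
    by (simp add: cstar_rel_def poly_cauchy_star poly_star_diff[symmetric] universalD(8))
qed


instance
proof
  fix x y z :: "'a cstar" and c d :: complex and r r' :: real
  show "c *\<^sub>C (x + y) = c *\<^sub>C x + c *\<^sub>C y"
    unfolding scaleC_cstar_def by transfer (simp add: cstar_rel_def poly_cauchy_scale poly_cauchy_add poly_scale_add)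
  show "(c + d) *\<^sub>C x = c *\<^sub>C x + d *\<^sub>C x"
    unfolding scaleC_cstar_def by transfer (simp add: cstar_rel_def poly_cauchy_scale poly_cauchy_add poly_scale_add_left)
  show "c *\<^sub>C (d *\<^sub>C x) = (c * d) *\<^sub>C x"
    unfolding scaleC_cstar_def by transfer (simp add: cstar_rel_def poly_cauchy_scale poly_scale_scale)
  show "(c *\<^sub>C x) * y = c *\<^sub>C (x * y)"
    unfolding scaleC_cstar_def by transfer (simp add: cstar_rel_def poly_cauchy_scale poly_cauchy_mult poly_scale_mult_left)
  show "x * (c *\<^sub>C y) = c *\<^sub>C (x * y)"
    unfolding scaleC_cstar_def by transfer (simp add: cstar_rel_def poly_cauchy_scale poly_cauchy_mult poly_scale_mult_right)
  show "norm (c *\<^sub>C x) = cmod c * norm x"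
  unfolding scaleC_cstar_def
  proof transfer
    fix c :: complex and X :: "nat \<Rightarrow> 'a star_poly" assume "poly_cauchy X"
    then show "lim (\<lambda>n. universal_seminorm (poly_scale c (X n))) = cmod c * lim (\<lambda>n. universal_seminorm (X n))"
      unfolding universalD(2) by (intro limI tendsto_mult_left poly_norm_lim)
  qed
  show "r *\<^sub>R x = complex_of_real r *\<^sub>C x"
    by (simp add: scaleC_cstar_def scaleR_cstar_def)
  show "star (x + y) = star x + star y"
    by transfer (simp add: cstar_rel_def poly_cauchy_star poly_cauchy_add poly_star_add)
  show "star (c *\<^sub>C x) = cnj c *\<^sub>C star x"
    unfolding scaleC_cstar_def by transfer (simp add: cstar_rel_def poly_cauchy_star poly_cauchy_scale poly_star_scale)
  show "star (x * y) = star y * star x"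
    by transfer (simp add: cstar_rel_def poly_cauchy_star poly_cauchy_mult poly_star_mult)
  show "star (star x) = x"
    by transfer (simp add: cstar_rel_def)
  show "norm (star x * x) = (norm x)\<^sup>2"
  proof transfer
    fix X :: "nat \<Rightarrow> 'a star_poly" assume "poly_cauchy X"
    then show "lim (\<lambda>n. universal_seminorm (poly_star (X n) * X n))
        = (lim (\<lambda>n. universal_seminorm (X n)))\<^sup>2"
      unfolding universalD(4) by (intro limI tendsto_power poly_norm_lim)
  qed
qed

end

definition cstar_gen :: "'s::monoid_mult \<Rightarrow> 's cstar" where
  "cstar_gen s = cstar_of_poly (poly_gen s)"

lemma cstar_of_poly_hom:
  "cstar_of_poly (x + y) = cstar_of_poly x + cstar_of_poly y"
  "cstar_of_poly (x * y) = cstar_of_poly x * cstar_of_poly y"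
  "cstar_of_poly (poly_star x) = star (cstar_of_poly x)"
  "cstar_of_poly (poly_scale c x) = c *\<^sub>C cstar_of_poly x"
  "cstar_of_poly 1 = 1" "cstar_of_poly 0 = 0"
  by (simp_all add: cstar_of_poly_def plus_cstar.abs_eq times_cstar.abs_eq star_cstar.abs_eq
      scaleC_cstar_def cstar_scale.abs_eq one_cstar_def zero_cstar_def cstar_rel_refl)

lemma cstar_of_poly_relation:
  assumes "(x, y) \<in> cstar_relations"
  shows "cstar_of_poly x = cstar_of_poly y"
proof -
  have "norm (cstar_of_poly x - cstar_of_poly y) = 0"
    by (simp only: cstar_of_poly_diff[symmetric] norm_cstar_of_poly universal_relation[OF assms])
  then show ?thesis by simp
qed

lemma cstar_gen_relations:
  "cstar_gen 1 = 1"
  "cstar_gen s * cstar_gen t = cstar_gen (s * t)"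
  "star (cstar_gen s) * cstar_gen s = 1"
  "right_ideal s \<inter> right_ideal t = right_ideal r \<Longrightarrow>
     cstar_gen s * star (cstar_gen s) * (cstar_gen t * star (cstar_gen t)) =
     cstar_gen r * star (cstar_gen r)"
  "right_ideal s \<inter> right_ideal t = {} \<Longrightarrow>
     cstar_gen s * star (cstar_gen s) * (cstar_gen t * star (cstar_gen t)) = 0"
  by (insert cstar_relations.intros[THEN cstar_of_poly_relation])
     (simp_all add: cstar_gen_def cstar_of_poly_hom)

lemma scaleC_0 [simp]: "0 *\<^sub>C x = 0" for x :: "'b::cstar_algebra"
  using scaleR_eq_scaleC[of 0 x] by simp

lemma scaleC_1 [simp]: "1 *\<^sub>C x = x" for x :: "'b::cstar_algebra"
  using scaleR_eq_scaleC[of 1 x] by simp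

lemma scaleC_0_right [simp]: "c *\<^sub>C 0 = 0" for c :: complex
  using scaleC_scaleC[of c 0] by simp

lemma star_0 [simp]: "star 0 = (0 :: 'b::cstar_algebra)"
  using star_scaleC[of 0 "0 :: 'b"] by simp

lemma star_1 [simp]: "star 1 = (1 :: 'b::cstar_algebra)"
  by (metis mult_1_left mult_1_right star_mult star_star)

lemma poly_eval_0 [simp]: "poly_eval w 0 = 0"
  by (simp add: poly_eval_def)

lemma poly_eval_single [simp]: "poly_eval w (Poly_Mapping.single u c) = c *\<^sub>C word_eval w u"
  by (cases "c = 0") (simp_all add: poly_eval_def)

lemma poly_eval_add: "poly_eval w (x + y) = poly_eval w x + poly_eval w y"
  unfolding poly_eval_def
  by (rule setsum_keys_plus_distrib) (simp_all add: scaleC_add_left)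

lemma poly_eval_scale: "poly_eval w (poly_scale c x) = c *\<^sub>C poly_eval w x"
  by (induction x rule: poly_mapping_additive_induct)
     (simp_all add: poly_scale_add poly_eval_add scaleC_add_right scaleC_scaleC)

lemma poly_eval_diff: "poly_eval w (x - y) = poly_eval w x - poly_eval w y"
  using poly_eval_add[of w "x - y" y] by simp

lemma word_eval_0 [simp]: "word_eval w 0 = 1"
  by (simp add: zero_star_word_def)

lemma word_eval_add: "word_eval w (u + v) = word_eval w u * word_eval w v"
  by (cases u; cases v) simp

lemma word_eval_star: "word_eval w (word_star u) = star (word_eval w u)"
proof (cases u)
  case (Word l)
  have "word_eval w (word_star (Word l)) = star (word_eval w (Word l))"
    by (induction l) (auto simp: star_mult star_star)
  then show ?thesis using Word by simp
qed

lemma poly_eval_mult: "poly_eval w (x * y) = poly_eval w x * poly_eval w y"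
proof (induction x rule: poly_mapping_additive_induct)
  case (single k c)
  show ?case
    by (induction y rule: poly_mapping_additive_induct)
       (simp_all add: poly_eval_add mult_single word_eval_add distrib_left
        mult_scaleC_left mult_scaleC_right scaleC_scaleC mult.commute)
qed (simp_all add: poly_eval_add distrib_right)

lemma poly_eval_star: "poly_eval w (poly_star x) = star (poly_eval w x)"
  by (induction x rule: poly_mapping_additive_induct)
     (simp_all add: poly_star_add poly_eval_add star_add star_scaleC word_eval_star)

lemma poly_eval_1 [simp]: "poly_eval w 1 = 1"
  by (simp flip: single_one)

lemma poly_eval_gen [simp]: "poly_eval w (poly_gen s) = w s"
  by (simp add: poly_gen_def)

lemma poly_eval_le:
  assumes "\<And>x y. (x, y) \<in> cstar_relations \<Longrightarrow> poly_eval w x = poly_eval w y"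
  shows "norm (poly_eval w x) \<le> universal_seminorm x"
proof (rule admissible_le_universal[where p = "\<lambda>x. norm (poly_eval w x)"])
  show "(\<lambda>x. norm (poly_eval w x)) \<in> admissible_seminorms"
    using assms
    by (auto simp: admissible_seminorms_def cstar_seminorm_def poly_eval_add poly_eval_scale
        poly_eval_mult poly_eval_star poly_eval_diff norm_scaleC norm_star_mult
        norm_triangle_ineq norm_mult_ineq)
qed

lemma star_hom_poly:
  assumes "star_hom f" "\<And>s. f (cstar_gen s) = w s"
  shows "f (cstar_of_poly x) = poly_eval w x"
proof -
  have f: "f (x + y) = f x + f y" "f (x * y) = f x * f y" "f (star x) = star (f x)"
    "f (c *\<^sub>C x) = c *\<^sub>C f x" "f 1 = 1" "f 0 = 0" for x y c
    using assms(1) unfolding star_hom_def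
    by (auto simp: linear_add linear_0 dest!: bounded_linear.linear)
  have letter: "f (cstar_of_poly (Poly_Mapping.single (Word [(s, b)]) 1)) = word_eval w (Word [(s, b)])"
    for s b
    using assms(2)[of s] f(3)[of "cstar_gen s"]
    by (cases b) (simp_all add: cstar_gen_def poly_gen_def flip: cstar_of_poly_hom)
  have word: "f (cstar_of_poly (Poly_Mapping.single (Word l) 1)) = word_eval w (Word l)" for l
  proof (induction l)
    case Nil
    then show ?case by (simp add: f cstar_of_poly_hom flip: zero_star_word_def)
  next
    case (Cons a l)
    have "Poly_Mapping.single (Word (a # l)) 1 =
        Poly_Mapping.single (Word [a]) 1 * Poly_Mapping.single (Word l) (1::complex)"
      by (simp add: mult_single)
    then show ?case using Cons letter[of "fst a" "snd a"] by (simp add: cstar_of_poly_hom f)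
  qed
  show ?thesis
  proof (induction x rule: poly_mapping_additive_induct)
    case (single k c)
    have "Poly_Mapping.single k c = poly_scale c (Poly_Mapping.single k 1)" by simp
    then show ?case using word by (cases k) (simp only: cstar_of_poly_hom f poly_eval_scale poly_eval_single scaleC_1)
  qed (simp_all add: f cstar_of_poly_hom poly_eval_add)
qed

theorem cstar_universal:
  fixes w :: "'s::monoid_mult \<Rightarrow> 'b::cstar_algebra"
  assumes rel: "\<And>x y. (x, y) \<in> cstar_relations \<Longrightarrow> poly_eval w x = poly_eval w y"
  shows "\<exists>!f. star_hom f \<and> (\<forall>s. f (cstar_gen s) = w s)"
proof (rule ex_ex1I)
  note le = poly_eval_le[OF rel]
  have conv: "convergent (\<lambda>n. poly_eval w (X n))" if "poly_cauchy X" for X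
  proof -
    have "Cauchy (\<lambda>n. poly_eval w (X n))"
      unfolding Cauchy_iff poly_eval_diff[symmetric]
      using that le_less_trans[OF le] unfolding poly_cauchy_def by metis
    then show ?thesis by (simp add: Cauchy_convergent_iff)
  qed
  have rep: "poly_cauchy (rep_cstar x)" "abs_cstar (rep_cstar x) = x" for x :: "'s cstar"
    using Quotient3_rep_reflp[OF Quotient3_cstar] Quotient3_abs_rep[OF Quotient3_cstar]
    by (auto simp: cstar_rel_refl)
  define f where "f x = lim (\<lambda>n. poly_eval w (rep_cstar x n))" for x
  have lim: "(\<lambda>n. poly_eval w (X n)) \<longlonglongrightarrow> f (abs_cstar X)" if X: "poly_cauchy X" for X
  proof -
    let ?Y = "rep_cstar (abs_cstar X)"
    have "cstar_rel X ?Y"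
      using X rep[of "abs_cstar X"] Quotient3_rel[OF Quotient3_cstar] by (metis cstar_rel_refl)
    then have "poly_null (\<lambda>n. X n - ?Y n)" by (simp add: cstar_rel_def)
    then have "(\<lambda>n. poly_eval w (X n) - poly_eval w (?Y n)) \<longlonglongrightarrow> 0"
      unfolding poly_null_def
      by (rule Lim_null_comparison[rotated]) (simp add: le flip: poly_eval_diff)
    moreover have "(\<lambda>n. poly_eval w (?Y n)) \<longlonglongrightarrow> f (abs_cstar X)"
      unfolding f_def using conv[OF rep(1)] by (simp only: convergent_LIMSEQ_iff)
    ultimately show ?thesis by (rule Lim_transform[rotated])
  qed
  have const: "f (cstar_of_poly x) = poly_eval w x" for x
    using LIMSEQ_unique[OF lim[OF poly_cauchy_const] tendsto_const]
    by (simp add: cstar_of_poly_def)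
  have add: "f (x + y) = f x + f y" for x y
  proof (cases x rule: cstar_cases, cases y rule: cstar_cases)
    fix X Y assume *: "poly_cauchy X" "x = abs_cstar X" "poly_cauchy Y" "y = abs_cstar Y"
    show ?thesis
      using LIMSEQ_unique[OF lim[OF poly_cauchy_add[OF *(1,3)], unfolded poly_eval_add]
          tendsto_add[OF lim[OF *(1)] lim[OF *(3)]]] *
      by (simp add: plus_cstar.abs_eq cstar_rel_refl)
  qed
  have mult: "f (x * y) = f x * f y" for x y
  proof (cases x rule: cstar_cases, cases y rule: cstar_cases)
    fix X Y assume *: "poly_cauchy X" "x = abs_cstar X" "poly_cauchy Y" "y = abs_cstar Y"
    show ?thesis
      using LIMSEQ_unique[OF lim[OF poly_cauchy_mult[OF *(1,3)], unfolded poly_eval_mult]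
          tendsto_mult[OF lim[OF *(1)] lim[OF *(3)]]] *
      by (simp add: times_cstar.abs_eq cstar_rel_refl)
  qed
  have bl_scale: "bounded_linear ((*\<^sub>C) c :: 'b \<Rightarrow> 'b)" for c
    by (rule bounded_linear_intro[of _ "cmod c"])
       (simp_all add: scaleC_add_right scaleR_eq_scaleC scaleC_scaleC norm_scaleC mult.commute)
  have scale: "f (c *\<^sub>C x) = c *\<^sub>C f x" for c x
  proof (cases x rule: cstar_cases)
    fix X assume *: "poly_cauchy X" "x = abs_cstar X"
    show ?thesis
      using LIMSEQ_unique[OF lim[OF poly_cauchy_scale[OF *(1)], of c, unfolded poly_eval_scale]
          bounded_linear.tendsto[OF bl_scale lim[OF *(1)]]] *
      by (simp add: scaleC_cstar_def cstar_scale.abs_eq cstar_rel_refl)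
  qed
  have norm_star: "norm (star y) = norm y" for y :: 'b
  proof -
    have le: "norm z \<le> norm (star z)" for z :: 'b
    proof (cases "norm z = 0")
      case False
      then have "norm z * norm z \<le> norm (star z) * norm z" "0 < norm z"
        using norm_mult_ineq[of "star z" z] by (auto simp: norm_star_mult power2_eq_square)
      then show ?thesis by simp
    qed (simp add: norm_ge_zero)
    show ?thesis using le[of y] le[of "star y"] by (simp add: star_star)
  qed
  have bl_star: "bounded_linear (star :: 'b \<Rightarrow> 'b)"
    by (rule bounded_linear_intro[of _ 1])
       (simp_all add: star_add scaleR_eq_scaleC star_scaleC norm_star)
  have star: "f (star x) = star (f x)" for x
  proof (cases x rule: cstar_cases)
    fix X assume *: "poly_cauchy X" "x = abs_cstar X"
    show ?thesis
      using LIMSEQ_unique[OF lim[OF poly_cauchy_star[OF *(1)], unfolded poly_eval_star]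
          bounded_linear.tendsto[OF bl_star lim[OF *(1)]]] *
      by (simp add: star_cstar.abs_eq cstar_rel_refl)
  qed
  have bound: "norm (f x) \<le> norm x" for x
  proof (cases x rule: cstar_cases)
    fix X assume *: "poly_cauchy X" "x = abs_cstar X"
    have "norm (f (abs_cstar X)) \<le> lim (\<lambda>n. universal_seminorm (X n))"
      by (rule LIMSEQ_le[OF tendsto_norm[OF lim[OF *(1)]] poly_norm_lim[OF *(1)]])
         (simp add: le)
    then show ?thesis
      using * by (simp add: norm_cstar.abs_eq cstar_rel_refl)
  qed
  have "bounded_linear f"
    by (rule bounded_linear_intro[of _ 1]) (simp_all add: add scale bound scaleR_eq_scaleC)
  moreover have "f 1 = 1"
    using const[of 1] by (simp add: cstar_of_poly_hom)
  ultimately have "star_hom f"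
    by (simp add: star_hom_def mult scale star)
  moreover have "f (cstar_gen s) = w s" for s
    using const[of "poly_gen s"] by (simp add: cstar_gen_def)
  ultimately show "\<exists>f. star_hom f \<and> (\<forall>s. f (cstar_gen s) = w s)" by blast
next
  fix f g :: "'s cstar \<Rightarrow> 'b"
  assume f: "star_hom f \<and> (\<forall>s. f (cstar_gen s) = w s)"
    and g: "star_hom g \<and> (\<forall>s. g (cstar_gen s) = w s)"
  show "f = g"
  proof
    fix x show "f x = g x"
    proof (cases x rule: cstar_cases)
      fix X assume X: "poly_cauchy X" "x = abs_cstar X"
      have "(\<lambda>n. f (cstar_of_poly (X n))) \<longlonglongrightarrow> f x" "(\<lambda>n. g (cstar_of_poly (X n))) \<longlonglongrightarrow> g x"
        using f g poly_cauchy_limit[OF X(1)] X(2) unfolding star_hom_def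
        by (auto intro: bounded_linear.tendsto)
      moreover have "f (cstar_of_poly (X n)) = g (cstar_of_poly (X n))" for n
        using star_hom_poly[of f w] star_hom_poly[of g w] f g by simp
      ultimately show ?thesis by (simp add: LIMSEQ_unique)
    qed
  qed
qed


section \<open>The dynamics defined by a scale\<close>

text \<open>\<open>scale_dynamics N t\<close> is the endomorphism $\sigma^N_t$ with $v_s \mapsto N(s)^{it} v_s$.
  It exists and is unique by the universal property.\<close>

definition scale_dynamics ::
    "('s::monoid_mult \<Rightarrow> real) \<Rightarrow> real \<Rightarrow> 's cstar \<Rightarrow> 's cstar" where
  "scale_dynamics N t = (THE f. star_hom f \<and>
     (\<forall>s. f (cstar_gen s) = (complex_of_real (N s) powr (\<i> * complex_of_real t)) *\<^sub>C cstar_gen s))"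

lemma scale_dynamics_props:
  fixes N :: "'s::monoid_mult \<Rightarrow> real"
  assumes N: "semigroup_scale N"
  shows "star_hom (scale_dynamics N t)"
    and "scale_dynamics N t (cstar_gen s) =
      (complex_of_real (N s) powr (\<i> * complex_of_real t)) *\<^sub>C cstar_gen s"
proof -
  define z where "z s = complex_of_real (N s) powr (\<i> * complex_of_real t)" for s
  have pos: "N s > 0" for s using N unfolding semigroup_scale_def by (metis less_le_trans zero_less_one)
  have mult: "z (s * u) = z s * z u" for s u
    using N pos[of s] pos[of u] unfolding z_def semigroup_scale_def
    by (simp add: powr_times_real less_imp_le)
  have "N 1 * N 1 = N 1" using N unfolding semigroup_scale_def by (metis mult_1)
  then have one: "z 1 = 1" using pos[of 1] by (simp add: z_def)
  have "cmod (z s) = 1" for s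
    using pos[of s] by (simp add: z_def norm_powr_real_powr)
  then have unit: "cnj (z s) * z s = 1" "z s * cnj (z s) = 1" for s
    using complex_norm_square[of "z s"] by (simp_all add: mult.commute)
  define w where "w s = z s *\<^sub>C cstar_gen s" for s
  have proj: "w s * star (w s) = cstar_gen s * star (cstar_gen s)" for s
    by (simp add: w_def star_scaleC mult_scaleC_left mult_scaleC_right scaleC_scaleC unit)
  have rel: "poly_eval w x = poly_eval w y" if "(x, y) \<in> cstar_relations" for x y
    using that
    by cases (simp_all add: poly_eval_mult poly_eval_star proj cstar_gen_relations,
      simp_all add: w_def one mult mult_scaleC_left mult_scaleC_right scaleC_scaleC star_scaleC
        unit cstar_gen_relations mult.commute)
  have "star_hom (scale_dynamics N t) \<and> (\<forall>s. scale_dynamics N t (cstar_gen s) = w s)"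
    using theI'[OF cstar_universal[of w, OF rel]]
    unfolding scale_dynamics_def w_def z_def by simp
  then show "star_hom (scale_dynamics N t)"
    "scale_dynamics N t (cstar_gen s) =
      (complex_of_real (N s) powr (\<i> * complex_of_real t)) *\<^sub>C cstar_gen s"
    by (simp_all add: w_def z_def)
qed

end

theory Submission
  imports Defs "HOL-Complex_Analysis.Complex_Analysis"
begin

text \<open>
  Write \<open>e\<^sub>s\<close> for the range projection of \<open>v\<^sub>s\<close>, respectively for its support in the spectrum.
  Both kinds of hypothesis give a positive normalised functional \<open>\<phi>\<close> with
  \<open>\<phi>(e\<^sub>s) = N(s)\<^sup>-\<^sup>\<beta>\<close>, and that is all the argument needs.  Indeed \<open>\<phi>(e\<^sub>s) \<le> 1\<close> excludes
  \<open>\<beta> < 0\<close> as soon as some \<open>N(s) > 1\<close>.  If \<open>N(t) = 1\<close>, then \<open>e\<^sub>t\<close> has full mass, hence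
  \<open>\<phi>(e\<^sub>se\<^sub>t) = \<phi>(e\<^sub>s) > 0\<close>.  So \<open>sS \<inter> tS\<close> is not empty, say \<open>sS \<inter> tS = rS\<close>,
  and \<open>N(r)\<^sup>-\<^sup>\<beta> = N(s)\<^sup>-\<^sup>\<beta>\<close>; for \<open>\<beta> > 0\<close> this forces \<open>N(r) = N(s)\<close>, that is,
  \<open>r \<in> s(ker N)\<close> (lemma \<open>scale_conditionI\<close>).

  For a scaling measure the point is that \<open>\<lambda>\<^sub>s\<close> maps the spectrum onto the set of the
  characters that are \<open>1\<close> at \<open>e\<^sub>s\<close> (lemmas \<open>action_image_idem\<close> and
  \<open>action_image_surj\<close>), so that this set has mass \<open>N(s)\<^sup>-\<^sup>\<beta>\<close>.

  For a KMS state the identity \<open>\<phi>(v\<^sub>sv\<^sub>s\<^sup>*) = N(s)\<^sup>-\<^sup>\<beta> \<phi>(v\<^sub>s\<^sup>*v\<^sub>s)\<close> is the KMS condition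
  for the eigenvector \<open>v\<^sub>s\<close> of the dynamics, but the dense subspace of the definition need not
  contain \<open>v\<^sub>s\<close> (lemma \<open>KMS_eigenvector\<close>).  Approximate \<open>v\<^sub>s\<close> and \<open>v\<^sub>s\<^sup>*\<close> by
  elements \<open>a, b\<close> of that subspace.  The function \<open>z \<mapsto> N(s)\<^sup>-\<^sup>i\<^sup>z \<phi>(b \<sigma>\<^sub>z(a))\<close> is entire, bounded on
  the strip between the lines \<open>Im z = 0\<close> and \<open>Im z = \<beta>\<close>, and uniformly close to a constant on each of the two lines.
  Its mean values over long parallel segments of the two lines differ little, since a primitive
  turns their difference into increments over the two short sides of a rectangle; hence the two constants
  are close to each other (lemma \<open>strip_boundary_constants\<close>).
\<close>


section \<open>The condition on the semigroup\<close>

lemma semigroup_scale_mult: "semigroup_scale N \<Longrightarrow> N (s * t) = N s * N t"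
  by (simp add: semigroup_scale_def)

lemma semigroup_scale_ge_1: "semigroup_scale N \<Longrightarrow> 1 \<le> N s"
  by (simp add: semigroup_scale_def)

lemma semigroup_scale_pos: "semigroup_scale N \<Longrightarrow> 0 < N s"
  using semigroup_scale_ge_1[of N s] by simp

lemma scale_conditionI:
  fixes N :: "'s::right_LCM_semigroup \<Rightarrow> real"
  assumes N: "semigroup_scale N" and nontrivial: "\<exists>s. N s \<noteq> 1"
    and le_1: "\<And>s. N s powr (- \<beta>) \<le> 1"
    and meet: "\<And>s t. N t = 1 \<Longrightarrow>
      \<exists>r. right_ideal s \<inter> right_ideal t = right_ideal r \<and> N s powr (- \<beta>) \<le> N r powr (- \<beta>)"
  shows "\<beta> = 0 \<or>
    (\<beta> > 0 \<and> (\<forall>s. \<forall>t\<in>scale_kernel N.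
       \<exists>r\<in>(*) s ` scale_kernel N. right_ideal s \<inter> right_ideal t = right_ideal r))"
proof (cases "\<beta> = 0")
  case False
  obtain s0 where s0: "N s0 > 1"
    using nontrivial semigroup_scale_ge_1[OF N] by (metis order_le_less)
  have pos: "\<beta> > 0"
  proof (rule ccontr)
    assume "\<not> \<beta> > 0"
    with False have "N s0 powr (- \<beta>) > 1" using s0 by (simp add: gr_one_powr)
    with le_1[of s0] show False by simp
  qed
  have "\<exists>r\<in>(*) s ` scale_kernel N. right_ideal s \<inter> right_ideal t = right_ideal r"
    if t: "t \<in> scale_kernel N" for s t
  proof -
    obtain r where r: "right_ideal s \<inter> right_ideal t = right_ideal r"
      and le: "N s powr (- \<beta>) \<le> N r powr (- \<beta>)"
      using meet[of t s] t by (auto simp: scale_kernel_def)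
    have "r \<in> right_ideal r" by (metis mult_1_right rangeI)
    then obtain u where u: "r = s * u" using r by blast
    have "N r \<le> N s"
    proof (rule ccontr)
      assume "\<not> N r \<le> N s"
      then have "N r powr (- \<beta>) < N s powr (- \<beta>)"
        using pos semigroup_scale_pos[OF N, of s] by (simp add: powr_less_mono2_neg)
      with le show False by simp
    qed
    then have "N s * N u \<le> N s * 1" by (simp add: u semigroup_scale_mult[OF N])
    then have "N u \<le> 1" using semigroup_scale_pos[OF N, of s] by simp
    then have "u \<in> scale_kernel N"
      using semigroup_scale_ge_1[OF N, of u] by (simp add: scale_kernel_def)
    then show ?thesis using r u by blast
  qed
  with pos show ?thesis by blast
qed simp


section \<open>Partial identities and the action on the spectrum\<close>

text \<open>The identity map of \<open>A\<close>, as a partial map.  The elements of \<open>E(S)\<close> are the partial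
  identities of the empty set and of the principal right ideals.\<close>

definition partial_id :: "'s set \<Rightarrow> 's \<rightharpoonup> 's" where
  "partial_id A = (\<lambda>y. if y \<in> A then Some y else None)"

text \<open>The domains of the elements of \<open>E(S)\<close>.\<close>

definition constructible :: "'s::monoid_mult set \<Rightarrow> bool" where
  "constructible A \<longleftrightarrow> A = {} \<or> (\<exists>s. A = right_ideal s)"

lemma dom_partial_id [simp]: "dom (partial_id A) = A"
  by (auto simp: partial_id_def dom_def)

lemma partial_id_comp: "partial_id A \<circ>\<^sub>m partial_id B = partial_id (A \<inter> B)"
  by (auto simp: partial_id_def map_comp_def)

lemma partial_id_empty: "partial_id {} = Map.empty"
  by (auto simp: partial_id_def)

lemma mult_left_eq_iff: "s * t = s * u \<longleftrightarrow> t = u" for s :: "'s::right_LCM_semigroup"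
  using left_cancel by blast

lemma partial_inv_left_mult:
  fixes s :: "'s::right_LCM_semigroup"
  shows "partial_inv (left_mult s) (s * t) = Some t"
    and "y \<notin> right_ideal s \<Longrightarrow> partial_inv (left_mult s) y = None"
proof -
  have ran: "ran (left_mult s) = right_ideal s" by (auto simp: ran_def left_mult_def)
  show "partial_inv (left_mult s) (s * t) = Some t"
    unfolding partial_inv_def ran by (simp add: left_mult_def mult_left_eq_iff)
  show "y \<notin> right_ideal s \<Longrightarrow> partial_inv (left_mult s) y = None"
    unfolding partial_inv_def ran by simp
qed

lemma idem_eq: "idem s = partial_id (right_ideal s)" for s :: "'s::right_LCM_semigroup"
proof
  fix y show "idem s y = partial_id (right_ideal s) y"
  proof (cases "y \<in> right_ideal s")
    case True
    then obtain t where "y = s * t" by blast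
    then show ?thesis
      using partial_inv_left_mult(1)[of s t]
      by (simp add: idem_def map_comp_def partial_id_def) (simp add: left_mult_def)
  next
    case False
    then show ?thesis
      by (simp add: idem_def map_comp_def partial_inv_left_mult partial_id_def)
  qed
qed

lemma idem_semilattice_eq:
  "idem_semilattice = partial_id ` {A :: 's::right_LCM_semigroup set. constructible A}"
proof -
  have "{A :: 's set. constructible A} = insert {} (range right_ideal)"
    by (auto simp: constructible_def)
  then show ?thesis
    by (simp add: idem_semilattice_def idem_eq image_image partial_id_empty)
qed

lemma partial_id_in_semilattice [simp]:
  "constructible A \<Longrightarrow> partial_id A \<in> idem_semilattice" for A :: "'s::right_LCM_semigroup set"
  by (simp add: idem_semilattice_eq)

lemma constructible_right_ideal [simp]: "constructible (right_ideal s)"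
  by (auto simp: constructible_def)

lemma constructible_empty [simp]: "constructible {}"
  by (simp add: constructible_def)

lemma right_ideal_1 [simp]: "right_ideal 1 = (UNIV :: 's::monoid_mult set)"
  by (auto simp: image_def)

lemma constructible_UNIV [simp]: "constructible (UNIV :: 's::monoid_mult set)"
  using constructible_right_ideal[of "1 :: 's"] by simp

lemma constructible_Int:
  fixes A :: "'s::right_LCM_semigroup set"
  assumes "constructible A" "constructible B"
  shows "constructible (A \<inter> B)"
  using assms right_LCM unfolding constructible_def by blast

lemma image_mult_right_ideal: "(*) r ` right_ideal s = right_ideal (r * s)"
  by (simp add: image_image mult.assoc)

lemma constructible_image:
  assumes "constructible A"
  shows "constructible ((*) r ` A)"
  using assms image_mult_right_ideal unfolding constructible_def by blast

lemma constructible_vimage: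
  fixes A :: "'s::right_LCM_semigroup set"
  assumes "constructible A"
  shows "constructible {t. r * t \<in> A}"
proof -
  have inj: "inj ((*) r)" by (simp add: inj_def mult_left_eq_iff)
  have image: "(*) r ` {t. r * t \<in> A} = A \<inter> right_ideal r" by auto
  have "constructible (A \<inter> right_ideal r)" using assms by (simp add: constructible_Int)
  then consider "A \<inter> right_ideal r = {}" | c where "A \<inter> right_ideal r = right_ideal c"
    by (auto simp: constructible_def)
  then show ?thesis
  proof cases
    case 1
    then show ?thesis using image by (simp add: constructible_def)
  next
    case (2 c)
    have "c \<in> right_ideal c" by (metis mult_1_right rangeI)
    then obtain d where "c = r * d" using 2 by blast
    then have "(*) r ` {t. r * t \<in> A} = (*) r ` right_ideal d"
      by (simp add: image 2 image_mult_right_ideal)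
    then have "{t. r * t \<in> A} = right_ideal d" using inj by (simp add: inj_image_eq_iff)
    then show ?thesis by simp
  qed
qed

lemma conjugate_partial_id:
  fixes s :: "'s::right_LCM_semigroup"
  shows "partial_inv (left_mult s) \<circ>\<^sub>m partial_id A \<circ>\<^sub>m left_mult s = partial_id {t. s * t \<in> A}"
proof
  fix t
  have "left_mult s t = Some (s * t)" by (simp add: left_mult_def)
  then show "(partial_inv (left_mult s) \<circ>\<^sub>m partial_id A \<circ>\<^sub>m left_mult s) t = partial_id {t. s * t \<in> A} t"
    using partial_inv_left_mult(1)[of s t] by (simp add: map_comp_def partial_id_def)
qed

lemma spectrum_action_partial_id:
  fixes A :: "'s::right_LCM_semigroup set"
  assumes "constructible A"
  shows "spectrum_action s \<xi> (partial_id A) = \<xi> (partial_id {t. s * t \<in> A})"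
  using assms by (simp add: spectrum_action_def conjugate_partial_id)

lemma spectrum_Int:
  fixes A :: "'s::right_LCM_semigroup set"
  assumes "\<xi> \<in> spectrum" "constructible A" "constructible B"
  shows "\<xi> (partial_id (A \<inter> B)) = \<xi> (partial_id A) * \<xi> (partial_id B)"
  using assms unfolding spectrum_def by (simp flip: partial_id_comp)

lemma spectrum_empty:
  "\<xi> \<in> spectrum \<Longrightarrow> \<xi> (partial_id {}) = 0" for \<xi> :: "('s::right_LCM_semigroup \<rightharpoonup> 's) \<Rightarrow> nat"
  by (simp add: spectrum_def partial_id_empty)

lemma spectrum_UNIV:
  fixes \<xi> :: "('s::right_LCM_semigroup \<rightharpoonup> 's) \<Rightarrow> nat"
  assumes "\<xi> \<in> spectrum"
  shows "\<xi> (partial_id UNIV) = 1"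
proof -
  obtain A :: "'s set" where A: "constructible A" "\<xi> (partial_id A) \<noteq> 0"
    using assms by (auto simp: spectrum_def idem_semilattice_eq)
  have "\<xi> (partial_id A) = \<xi> (partial_id A) * \<xi> (partial_id UNIV)"
    using spectrum_Int[OF assms A(1) constructible_UNIV] by simp
  with A(2) show ?thesis by simp
qed

lemma action_image_idem:
  fixes s :: "'s::right_LCM_semigroup"
  assumes "\<eta> \<in> spectrum_action s ` spectrum"
  shows "\<eta> (partial_id (right_ideal s)) = 1"
  using assms by (auto simp: spectrum_action_partial_id spectrum_UNIV)

text \<open>The preimage of \<open>\<eta>\<close> under \<open>\<lambda>\<^sub>r\<close> is the character \<open>e\<^sub>u \<mapsto> \<eta>(e\<^bsub>ru\<^esub>)\<close>; it is not zero
  because its value at the unit is \<open>\<eta>(e\<^sub>r)\<close>.\<close>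

lemma action_image_surj:
  fixes r :: "'s::right_LCM_semigroup"
  assumes \<eta>: "\<eta> \<in> spectrum" and r: "\<eta> (partial_id (right_ideal r)) = 1"
  shows "\<eta> \<in> spectrum_action r ` spectrum"
proof
  define \<psi> where "\<psi> = (\<lambda>e\<in>idem_semilattice. \<eta> (partial_id ((*) r ` dom e)))"
  have \<psi>: "\<psi> (partial_id A) = \<eta> (partial_id ((*) r ` A))" if "constructible A" for A
    using that by (simp add: \<psi>_def)
  have inj: "inj ((*) r)" by (simp add: inj_def mult_left_eq_iff)
  show "\<psi> \<in> spectrum"
    unfolding spectrum_def
  proof (intro CollectI conjI ballI)
    have "\<psi> e \<in> {0, 1}" if e: "e \<in> idem_semilattice" for e
    proof -
      obtain A where A: "e = partial_id A" "constructible A"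
        using e by (auto simp: idem_semilattice_eq)
      have "partial_id ((*) r ` A) \<in> idem_semilattice"
        using A by (simp add: constructible_image)
      then show ?thesis using A \<eta> \<psi>[of A] by (auto simp: spectrum_def)
    qed
    then show "\<psi> \<in> idem_semilattice \<rightarrow>\<^sub>E {0, 1}"
      by (auto simp: \<psi>_def)
    show "\<exists>e\<in>idem_semilattice. \<psi> e \<noteq> 0"
      using \<psi>[OF constructible_UNIV] r by (intro bexI[of _ "partial_id UNIV"]) auto
    show "\<psi> Map.empty = 0"
      using \<psi>[OF constructible_empty] spectrum_empty[OF \<eta>] by (simp add: partial_id_empty)
    fix e f :: "'s \<rightharpoonup> 's" assume "e \<in> idem_semilattice" "f \<in> idem_semilattice"
    then obtain A B where AB: "e = partial_id A" "constructible A" "f = partial_id B" "constructible B"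
      by (auto simp: idem_semilattice_eq)
    then show "\<psi> (e \<circ>\<^sub>m f) = \<psi> e * \<psi> f"
      by (simp add: partial_id_comp \<psi> constructible_Int constructible_image
          image_Int[OF inj] spectrum_Int[OF \<eta>])
  qed
  show "\<eta> = spectrum_action r \<psi>"
  proof
    fix e :: "'s \<rightharpoonup> 's"
    show "\<eta> e = spectrum_action r \<psi> e"
    proof (cases "e \<in> idem_semilattice")
      case True
      then obtain A where A: "e = partial_id A" "constructible A"
        by (auto simp: idem_semilattice_eq)
      have "(*) r ` {t. r * t \<in> A} = A \<inter> right_ideal r" by auto
      then show ?thesis
        using A r by (simp add: spectrum_action_partial_id \<psi> constructible_vimage spectrum_Int[OF \<eta>])
    next
      case False
      then show ?thesis using \<eta> by (auto simp: spectrum_def spectrum_action_def)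
    qed
  qed
qed


section \<open>Scaling measures\<close>

lemma scaling_measure_condition:
  fixes N :: "'s::right_LCM_semigroup \<Rightarrow> real"
  assumes N: "semigroup_scale N" and \<mu>: "scaling_measure N \<beta> \<mu>"
  shows "N s powr (- \<beta>) \<le> 1"
    and "N t = 1 \<Longrightarrow>
      \<exists>r. right_ideal s \<inter> right_ideal t = right_ideal r \<and> N s powr (- \<beta>) \<le> N r powr (- \<beta>)"
proof -
  interpret prob_space \<mu> using \<mu> by (simp add: scaling_measure_def)
  have sets: "sets \<mu> = sets spectrum_borel" using \<mu> by (simp add: scaling_measure_def)
  have "topspace (spectrum_topology :: (('s \<rightharpoonup> 's) \<Rightarrow> nat) topology) = spectrum"
    by (auto simp: spectrum_topology_def spectrum_def)
  then have space_borel: "space (spectrum_borel :: (('s \<rightharpoonup> 's) \<Rightarrow> nat) measure) = spectrum"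
    by (simp add: spectrum_borel_def space_measure_of_conv)
  then have space: "space \<mu> = spectrum" using sets_eq_imp_space_eq[OF sets] by simp
  let ?I = "\<lambda>s :: 's. spectrum_action s ` spectrum"
  have I: "prob (?I s) = N s powr (- \<beta>)" for s
  proof -
    have "spectrum \<in> sets (spectrum_borel :: (('s \<rightharpoonup> 's) \<Rightarrow> nat) measure)"
      by (metis sets.top space_borel)
    then have "prob (?I s) = N s powr (- \<beta>) * prob spectrum"
      using \<mu> by (simp add: scaling_measure_def)
    then show ?thesis using prob_space by (simp add: space)
  qed
  show "N s powr (- \<beta>) \<le> 1" using I[of s] prob_le_1 by metis
  \<comment> \<open>Sets that are not measurable have measure 0 by convention.\<close>
  have meas: "?I s \<in> events" for s
    using I[of s] semigroup_scale_pos[OF N, of s] measure_notin_sets by force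
  have sub: "?I s \<subseteq> spectrum" for s
    using sets.sets_into_space[OF meas[of s]] space by simp
  show "\<exists>r. right_ideal s \<inter> right_ideal t = right_ideal r \<and> N s powr (- \<beta>) \<le> N r powr (- \<beta>)"
    if t: "N t = 1"
  proof -
    have "prob (?I t) = 1" using I[of t] t by simp
    then have "prob (space \<mu> - ?I t) = 0" by (simp add: prob_compl meas)
    moreover have "prob (?I s - ?I t) \<le> prob (space \<mu> - ?I t)"
      using sub[of s] by (intro finite_measure_mono Diff_mono sets.compl_sets meas) (auto simp: space)
    ultimately have "prob (?I s - ?I t) = 0" by (simp add: measure_le_0_iff)
    then have eq: "prob (?I s \<inter> ?I t) = N s powr (- \<beta>)"
      using finite_measure_Diff'[OF meas meas, of s t] I[of s] by simp
    have one: "\<eta> (partial_id (right_ideal s \<inter> right_ideal t)) = 1" if "\<eta> \<in> ?I s \<inter> ?I t" for \<eta>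
      using that sub[of s] action_image_idem[of \<eta> s] action_image_idem[of \<eta> t]
      by (subst spectrum_Int) auto
    have "?I s \<inter> ?I t \<noteq> {}"
      using eq semigroup_scale_pos[OF N, of s] by (intro notI) simp
    then obtain \<eta> where \<eta>: "\<eta> \<in> ?I s \<inter> ?I t" by blast
    then have "\<eta> \<in> spectrum" using sub[of s] by blast
    then have "right_ideal s \<inter> right_ideal t \<noteq> {}"
      using one[OF \<eta>] spectrum_empty[of \<eta>] by (intro notI) simp
    then obtain r where r: "right_ideal s \<inter> right_ideal t = right_ideal r"
      using right_LCM by blast
    have "?I s \<inter> ?I t \<subseteq> ?I r"
    proof
      fix \<eta> assume \<eta>: "\<eta> \<in> ?I s \<inter> ?I t"
      then have "\<eta> \<in> spectrum" using sub[of s] by blast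
      then show "\<eta> \<in> ?I r" using one[OF \<eta>] unfolding r by (rule action_image_surj)
    qed
    then have "prob (?I s \<inter> ?I t) \<le> prob (?I r)"
      using meas by (intro finite_measure_mono)
    then show ?thesis using r I[of r] eq by auto
  qed
qed


section \<open>States on C*-algebras\<close>

lemma norm_1_le: "norm (1 :: 'a::cstar_algebra) \<le> 1"
proof -
  have "norm (1 :: 'a) = norm (1 :: 'a) * norm (1 :: 'a)"
    using norm_star_mult[of "1 :: 'a"] by (simp add: power2_eq_square)
  then show ?thesis by (metis mult_cancel_left1 mult_zero_class.mult_zero_left order.refl zero_le_one)
qed

lemma cstar_state_linear:
  assumes "cstar_state \<phi>"
  shows "bounded_linear \<phi>" "\<phi> (x + y) = \<phi> x + \<phi> y" "\<phi> (x - y) = \<phi> x - \<phi> y"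
    "\<phi> (c *\<^sub>C x) = c * \<phi> x" "\<phi> 0 = 0"
proof -
  show bl: "bounded_linear \<phi>" using assms by (simp add: cstar_state_def)
  interpret bounded_linear \<phi> by (rule bl)
  show "\<phi> (x + y) = \<phi> x + \<phi> y" "\<phi> (x - y) = \<phi> x - \<phi> y" "\<phi> 0 = 0"
    by (simp_all add: add diff zero)
  show "\<phi> (c *\<^sub>C x) = c * \<phi> x" using assms by (simp add: cstar_state_def)
qed

lemma cstar_state_norm_le:
  assumes "cstar_state \<phi>"
  shows "norm (\<phi> x) \<le> norm x"
  using onorm[of \<phi> x] assms by (simp add: cstar_state_def)

lemma cstar_state_positive:
  assumes "cstar_state \<phi>"
  shows "\<phi> (star x * x) = of_real (Re (\<phi> (star x * x)))" "0 \<le> Re (\<phi> (star x * x))"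
  using assms by (auto simp: cstar_state_def complex_is_Real_iff complex_eq_iff)

lemma star_diff: "star (x - y) = star x - star y" for x :: "'a::cstar_algebra"
  using star_add[of "x - y" y] by (simp add: algebra_simps)

lemma cstar_state_Cauchy_Schwarz:
  fixes x y :: "'a::cstar_algebra"
  assumes \<phi>: "cstar_state \<phi>"
  shows "(cmod (\<phi> (star x * y)))\<^sup>2 \<le> Re (\<phi> (star x * x)) * Re (\<phi> (star y * y))"
proof -
  note lin = cstar_state_linear[OF \<phi>]
  define A B z w where "A = Re (\<phi> (star x * x))" and "B = Re (\<phi> (star y * y))"
    and "z = \<phi> (star x * y)" and "w = \<phi> (star y * x)"
  have A: "\<phi> (star x * x) = of_real A" "0 \<le> A" and B: "\<phi> (star y * y) = of_real B" "0 \<le> B"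
    using cstar_state_positive[OF \<phi>] unfolding A_def B_def by blast+
  have expand: "\<phi> (star (c *\<^sub>C x + y) * (c *\<^sub>C x + y)) = cnj c * c * A + cnj c * z + c * w + B" for c
    by (simp add: star_add star_scaleC distrib_left distrib_right mult_scaleC_left mult_scaleC_right
        scaleC_scaleC lin A B z_def w_def algebra_simps)
  have real: "Im (cnj c * z + c * w) = 0" for c
    using cstar_state_positive(1)[OF \<phi>, of "c *\<^sub>C x + y"] unfolding expand
    by (simp add: complex_eq_iff)
  have "w = cnj z" using real[of 1] real[of \<i>] by (simp add: complex_eq_iff)
  then have pos: "0 \<le> (cmod c)\<^sup>2 * A + 2 * Re (cnj c * z) + B" for c
    using cstar_state_positive(2)[OF \<phi>, of "c *\<^sub>C x + y"] unfolding expand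
    by (simp add: cmod_power2 algebra_simps) (simp add: power2_eq_square)
  \<comment> \<open>For \<open>c = - r z\<close> with real \<open>r\<close> this is a quadratic polynomial in \<open>r\<close>,
    minimal at \<open>r = 1 / A\<close>.\<close>
  have quad: "0 \<le> r\<^sup>2 * (cmod z)\<^sup>2 * A - 2 * r * (cmod z)\<^sup>2 + B" for r :: real
  proof -
    have "cnj z * z = of_real ((cmod z)\<^sup>2)" using complex_norm_square[of z] by (simp add: mult.commute)
    then have "cnj (- of_real r * z) * z = of_real (- (r * (cmod z)\<^sup>2))"
      by (simp add: mult.assoc)
    then have "Re (cnj (- of_real r * z) * z) = - (r * (cmod z)\<^sup>2)"
      by (simp only: Re_complex_of_real)
    moreover have "(cmod (- of_real r * z))\<^sup>2 = r\<^sup>2 * (cmod z)\<^sup>2"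
      by (simp add: norm_mult power_mult_distrib)
    ultimately show ?thesis using pos[of "- of_real r * z"] by simp
  qed
  have "(cmod z)\<^sup>2 \<le> A * B"
  proof (cases "A = 0")
    case True
    show ?thesis
    proof (rule ccontr)
      assume "\<not> ?thesis"
      then have "(cmod z)\<^sup>2 > 0" using True by simp
      then show False using quad[of "(B + 1) / (cmod z)\<^sup>2"] True B by simp
    qed
  next
    case False
    then have "0 \<le> A * ((1 / A)\<^sup>2 * (cmod z)\<^sup>2 * A - 2 * (1 / A) * (cmod z)\<^sup>2 + B)"
      using mult_nonneg_nonneg[OF A(2) quad[of "1 / A"]] by simp
    also have "\<dots> = A * B - (cmod z)\<^sup>2" using False by (simp add: power2_eq_square field_simps)
    finally show ?thesis by simp
  qed
  then show ?thesis by (simp add: z_def A_def B_def)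
qed

text \<open>As \<open>|\<phi>(x)|\<^sup>2 \<le> \<phi>(1) \<phi>(x\<^sup>*x) \<le> \<phi>(1) \<parallel>x\<parallel>\<^sup>2\<close>, the norm of a state is at most
  \<open>\<phi>(1)\<^sup>1\<^sup>/\<^sup>2\<close>.\<close>

lemma cstar_state_1:
  fixes \<phi> :: "'a::cstar_algebra \<Rightarrow> complex"
  assumes \<phi>: "cstar_state \<phi>"
  shows "\<phi> 1 = 1"
proof -
  define p where "p = Re (\<phi> 1)"
  have p: "\<phi> 1 = of_real p" "0 \<le> p"
    unfolding p_def by (rule cstar_state_positive[OF \<phi>, of 1, unfolded star_1 mult_1_left])+
  have "norm (\<phi> 1) \<le> 1" using cstar_state_norm_le[OF \<phi>, of 1] norm_1_le[where 'a='a] by linarith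
  then have "p \<le> 1" using p by simp
  have "norm (\<phi> x) \<le> sqrt p * norm x" for x
  proof -
    have "Re (\<phi> (star x * x)) \<le> (norm x)\<^sup>2"
      using cstar_state_norm_le[OF \<phi>, of "star x * x"] complex_Re_le_cmod[of "\<phi> (star x * x)"]
      by (simp add: norm_star_mult)
    then have "p * Re (\<phi> (star x * x)) \<le> p * (norm x)\<^sup>2"
      by (rule mult_left_mono) (rule p(2))
    moreover have "(norm (\<phi> x))\<^sup>2 \<le> p * Re (\<phi> (star x * x))"
      using cstar_state_Cauchy_Schwarz[OF \<phi>, of 1 x] by (simp add: p_def)
    ultimately have "(norm (\<phi> x))\<^sup>2 \<le> (sqrt p * norm x)\<^sup>2"
      using p by (simp add: power_mult_distrib)
    then show ?thesis by (rule power2_le_imp_le) (simp add: p(2))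
  qed
  then have "onorm \<phi> \<le> sqrt p" by (rule onorm_bound[rotated]) (simp add: p(2))
  then have "1 \<le> p" using \<phi> by (simp add: cstar_state_def)
  with \<open>p \<le> 1\<close> show ?thesis using p by simp
qed


section \<open>The KMS condition for eigenvectors of the dynamics\<close>

text \<open>The difference of \<open>c\<close> and \<open>d\<close> is compared with the mean values of \<open>h\<close> over
  \<open>[-R, R]\<close> and \<open>[-R, R] + i\<beta>\<close>.  A primitive of \<open>h\<close> expresses the difference of these
  means by the two short sides of the rectangle, whose contribution is \<open>O(1/R)\<close>.\<close>

lemma strip_boundary_constants:
  fixes h :: "complex \<Rightarrow> complex" and \<beta> :: real
  assumes h: "h holomorphic_on UNIV"
    and lower: "\<And>t::real. norm (h (of_real t) - c) \<le> \<epsilon>"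
    and upper: "\<And>t::real. norm (h (of_real t + \<i> * of_real \<beta>) - d) \<le> \<delta>"
    and strip: "\<And>t y::real. y \<in> closed_segment 0 \<beta> \<Longrightarrow> norm (h (of_real t + \<i> * of_real y)) \<le> C"
  shows "norm (c - d) \<le> \<epsilon> + \<delta>"
proof -
  obtain H where H: "\<And>z. (H has_field_derivative h z) (at z)"
    using holomorphic_convex_primitive'[OF _ _ h] by auto
  have side: "norm (H (of_real t + \<i> * of_real \<beta>) - H (of_real t)) \<le> C * \<bar>\<beta>\<bar>" for t
  proof -
    let ?S = "closed_segment (of_real t) (of_real t + \<i> * of_real \<beta>)"
    have "norm (h z) \<le> C" if "z \<in> ?S" for z
    proof -
      obtain u where u: "0 \<le> u" "u \<le> 1"
        "z = (1 - u) *\<^sub>R of_real t + u *\<^sub>R (of_real t + \<i> * of_real \<beta>)"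
        using \<open>z \<in> ?S\<close> by (auto simp: closed_segment_def)
      then have "z = of_real t + \<i> * of_real (u * \<beta>)"
        by (simp add: scaleR_conv_of_real algebra_simps)
      moreover have "u * \<beta> \<in> closed_segment 0 \<beta>"
        using u by (auto simp: closed_segment_def)
      ultimately show ?thesis using strip by blast
    qed
    then have "norm (H (of_real t + \<i> * of_real \<beta>) - H (of_real t))
        \<le> C * norm (of_real t + \<i> * of_real \<beta> - complex_of_real t)"
      by (intro field_differentiable_bound[of ?S H h C] has_field_derivative_at_within[OF H]) auto
    then show ?thesis by (simp add: norm_mult)
  qed
  have line: "norm (H (of_real R + w) - H (of_real (- R) + w) - of_real (2 * R) * k) \<le> 2 * R * e"
    if "R > 0" "\<And>t::real. norm (h (of_real t + w) - k) \<le> e" for R w k e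
  proof -
    let ?S = "closed_segment (of_real (- R) + w) (of_real R + w)"
    have "norm (h z - k) \<le> e" if "z \<in> ?S" for z
    proof -
      obtain u where "z = (1 - u) *\<^sub>R (of_real (- R) + w) + u *\<^sub>R (of_real R + w)"
        using \<open>z \<in> ?S\<close> by (auto simp: closed_segment_def)
      then have "z = of_real (2 * u * R - R) + w"
        by (simp add: scaleR_conv_of_real algebra_simps)
      then show ?thesis using \<open>\<And>t::real. norm (h (of_real t + w) - k) \<le> e\<close> by blast
    qed
    moreover have "((\<lambda>z. H z - k * z) has_field_derivative (h z - k)) (at z within ?S)" for z
      using H by (auto intro!: derivative_eq_intros simp: has_field_derivative_at_within)
    ultimately have "norm ((H (of_real R + w) - k * (of_real R + w))
        - (H (of_real (- R) + w) - k * (of_real (- R) + w)))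
      \<le> e * norm ((of_real R + w) - (of_real (- R) + w))"
      by (intro field_differentiable_bound[of ?S]) auto
    moreover have "norm ((of_real R + w) - (of_real (- R) + w)) = 2 * R"
    proof -
      have "(of_real R + w) - (of_real (- R) + w) = of_real (2 * R)" by simp
      then show ?thesis using \<open>R > 0\<close> by (simp only: norm_of_real)
    qed
    ultimately show ?thesis by (simp add: algebra_simps)
  qed
  have bound: "norm (c - d) \<le> \<epsilon> + \<delta> + C * \<bar>\<beta>\<bar> / R" if R: "R > 0" for R
  proof -
    let ?b = "\<i> * complex_of_real \<beta>"
    have "of_real (2 * R) * (c - d) =
        - (H (of_real R + 0) - H (of_real (- R) + 0) - of_real (2 * R) * c)
        - (H (of_real R + ?b) - H (of_real R))
        + (H (of_real (- R) + ?b) - H (of_real (- R)))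
        + (H (of_real R + ?b) - H (of_real (- R) + ?b) - of_real (2 * R) * d)"
      (is "_ = - ?x - ?y + ?z + ?w")
      by (simp add: algebra_simps)
    then have "norm (of_real (2 * R) * (c - d)) = norm (- ?x - ?y + ?z + ?w)" by simp
    also have "\<dots> \<le> norm ?x + norm ?y + norm ?z + norm ?w"
      by (smt (verit) norm_triangle_ineq norm_triangle_ineq4 norm_minus_cancel)
    also have "\<dots> \<le> 2 * R * \<epsilon> + C * \<bar>\<beta>\<bar> + C * \<bar>\<beta>\<bar> + 2 * R * \<delta>"
      using lower upper by (intro add_mono side line R) auto
    also have "norm (of_real (2 * R) * (c - d)) = 2 * R * norm (c - d)"
      using R by (simp add: norm_mult)
    finally have "2 * R * norm (c - d) \<le> 2 * R * (\<epsilon> + \<delta> + C * \<bar>\<beta>\<bar> / R)"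
      using R by (simp add: algebra_simps)
    then show ?thesis using R by (simp only: mult_le_cancel_left_pos)
  qed
  have "((\<lambda>R. \<epsilon> + \<delta> + C * \<bar>\<beta>\<bar> / R) \<longlongrightarrow> \<epsilon> + \<delta> + 0) at_top"
    by (intro tendsto_intros tendsto_divide_0[OF tendsto_const] filterlim_at_top_imp_at_infinity filterlim_ident)
  then show ?thesis
    using bound by (intro tendsto_lowerbound[where F = at_top and f = "\<lambda>R. \<epsilon> + \<delta> + C * \<bar>\<beta>\<bar> / R"])
      (auto simp: eventually_at_top_dense intro: exI[of _ 0])
qed

lemma entire_isCont:
  fixes F :: "complex \<Rightarrow> 'a::cstar_algebra"
  assumes "entire F"
  shows "isCont F z"
proof -
  obtain D where D: "((\<lambda>h. inverse h *\<^sub>C (F (z + h) - F z)) \<longlongrightarrow> D) (at 0)"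
    using assms by (auto simp: entire_def)
  have "((\<lambda>h. cmod h * norm (inverse h *\<^sub>C (F (z + h) - F z))) \<longlongrightarrow> 0 * norm D) (at 0)"
    by (intro tendsto_mult tendsto_norm_zero tendsto_norm D tendsto_ident_at)
  moreover have "\<forall>\<^sub>F h in at 0. cmod h * norm (inverse h *\<^sub>C (F (z + h) - F z)) = norm (F (z + h) - F z)"
  proof (rule eventually_at_filter[THEN iffD2], rule always_eventually, intro allI impI)
    fix h :: complex assume "h \<noteq> 0"
    then show "cmod h * norm (inverse h *\<^sub>C (F (z + h) - F z)) = norm (F (z + h) - F z)"
      by (simp add: norm_scaleC norm_inverse)
  qed
  ultimately have "((\<lambda>h. norm (F (z + h) - F z)) \<longlongrightarrow> 0 * norm D) (at 0)"
    by (rule Lim_transform_eventually)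
  then have "((\<lambda>h. norm (F (z + h) - F z)) \<longlongrightarrow> 0) (at 0)"
    by (simp only: mult_zero_left)
  then have "((\<lambda>h. F (z + h) - F z) \<longlongrightarrow> 0) (at 0)"
    by (rule tendsto_norm_zero_cancel)
  then have "((\<lambda>h. F (z + h)) \<longlongrightarrow> F z) (at 0)"
    by (rule LIM_zero_cancel)
  then show ?thesis by (simp only: isCont_iff)
qed

lemma entire_functional_holomorphic:
  fixes F :: "complex \<Rightarrow> 'a::cstar_algebra"
  assumes F: "entire F" and L: "bounded_linear L" "\<And>c x. L (c *\<^sub>C x) = c * L x"
  shows "(\<lambda>z. L (F z) :: complex) holomorphic_on UNIV"
proof -
  interpret bounded_linear L by (rule L)
  have "(\<lambda>z. L (F z)) field_differentiable at z" for z
  proof -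
    obtain D where D: "((\<lambda>h. inverse h *\<^sub>C (F (z + h) - F z)) \<longlongrightarrow> D) (at 0)"
      using F by (auto simp: entire_def)
    have "((\<lambda>h. (L (F (z + h)) - L (F z)) / h) \<longlongrightarrow> L D) (at 0)"
      using tendsto[OF D] by (simp add: L(2) diff field_simps)
    then show ?thesis unfolding field_differentiable_def DERIV_def by blast
  qed
  then show ?thesis by (simp add: holomorphic_on_def)
qed

lemma holomorphic_eq_if_eq_on_reals:
  fixes f g :: "complex \<Rightarrow> complex"
  assumes f: "f holomorphic_on UNIV" and g: "g holomorphic_on UNIV"
    and eq: "\<And>t::real. f (of_real t) = g (of_real t)"
  shows "f z = g z"
proof -
  have "(\<lambda>z. f z - g z) holomorphic_on UNIV" using f g by (intro holomorphic_intros)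
  moreover have "0 islimpt (\<real> :: complex set)"
    unfolding islimpt_approachable
  proof (intro allI impI)
    fix e :: real assume "e > 0"
    then show "\<exists>x'\<in>\<real>. x' \<noteq> 0 \<and> dist x' (0::complex) < e"
      by (intro bexI[of _ "of_real (e / 2)"]) auto
  qed
  moreover have "f z - g z = 0" if "z \<in> \<real>" for z
    using that eq by (auto elim: Reals_cases)
  ultimately have "f z - g z = 0"
    using analytic_continuation[of "\<lambda>z. f z - g z" UNIV \<real> 0 z] by auto
  then show ?thesis by simp
qed

lemma star_hom_linear:
  assumes "star_hom f"
  shows "bounded_linear f" "f (c *\<^sub>C x) = c *\<^sub>C f x"
  using assms unfolding star_hom_def by blast+

text \<open>Neither \<open>v\<close> nor \<open>w\<close> need belong to the dense subspace in the KMS condition.  Only scalar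
  functions \<open>z \<mapsto> \<phi>(b F(z))\<close> of the analytic orbits \<open>F\<close> occur, so that the scalar identity theorem
  is enough to compare orbits.\<close>

lemma KMS_eigenvector:
  fixes \<sigma> :: "real \<Rightarrow> 'a \<Rightarrow> 'a::cstar_algebra" and v w :: 'a and l :: real
  assumes \<phi>: "KMS_state \<sigma> \<beta> \<phi>"
    and hom: "\<And>t. star_hom (\<sigma> t)"
    and contractive: "\<And>t x. norm (\<sigma> t x) \<le> norm x"
    and group: "\<And>t u x. \<sigma> t (\<sigma> u x) = \<sigma> (t + u) x"
    and eigen: "\<And>t. \<sigma> t v = exp (\<i> * of_real (l * t)) *\<^sub>C v"
  shows "\<phi> (w * v) = exp (of_real (l * \<beta>)) * \<phi> (v * w)"
proof -
  have state: "cstar_state \<phi>" using \<phi> by (simp only: KMS_state_def)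
  obtain D where D_conj: "complex_subspace D \<and> closure D = UNIV \<and> (\<forall>t. \<sigma> t ` D \<subseteq> D) \<and>
      (\<forall>a\<in>D. \<exists>F. analytic_orbit \<sigma> a F \<and>
         (\<forall>b\<in>D. \<phi> (a * b) = \<phi> (b * F (\<i> * complex_of_real \<beta>))))"
    using \<phi>[unfolded KMS_state_def, THEN conjunct2] by (rule exE)
  have D: "closure D = UNIV" "\<And>t. \<sigma> t ` D \<subseteq> D" using D_conj by iprover+
  have KMS: "\<exists>F. analytic_orbit \<sigma> a F \<and>
      (\<forall>b\<in>D. \<phi> (a * b) = \<phi> (b * F (\<i> * complex_of_real \<beta>)))" if "a \<in> D" for a
    using D_conj[THEN conjunct2, THEN conjunct2, THEN conjunct2] that by (rule bspec)
  have \<sigma>_D: "\<sigma> t x \<in> D" if "x \<in> D" for t x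
    using D(2) that by blast
  note lin = cstar_state_linear[OF state]
  have blL: "bounded_linear (\<lambda>x. \<phi> (b * x))" for b
    by (rule bounded_linear_compose[OF lin(1) bounded_linear_mult_right])
  have scL: "\<phi> (b * (c *\<^sub>C x)) = c * \<phi> (b * x)" for b c x
    by (simp add: mult_scaleC_right lin)
  let ?e = "\<lambda>a b. norm b * norm (a - v) + norm (b - w) * norm v"
  have approx: "norm (\<phi> (w * v) - exp (of_real (l * \<beta>)) * \<phi> (v * w))
      \<le> ?e a b + exp (l * \<beta>) * ?e a b"
    if a: "a \<in> D" and b: "b \<in> D" for a b
  proof -
    obtain F where F: "entire F" "\<And>t. F (of_real t) = \<sigma> t a"
      using KMS[OF a] unfolding analytic_orbit_def by blast
    have F_add: "F (of_real u + of_real t) = \<sigma> (u + t) a" for u t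
      using F(2)[of "u + t"] by (simp only: of_real_add)
    define g where "g z = \<phi> (b * F z)" for z
    have g_hol: "g holomorphic_on UNIV"
      unfolding g_def by (rule entire_functional_holomorphic[OF F(1) blL]) (rule scL)
    have "(g \<circ> (\<lambda>z. z + of_real t)) holomorphic_on UNIV" for t
      by (intro holomorphic_on_compose holomorphic_on_add holomorphic_on_ident
          holomorphic_on_const holomorphic_on_subset[OF g_hol] subset_UNIV)
    then have shift_hol: "(\<lambda>z. g (z + of_real t)) holomorphic_on UNIV" for t
      by (simp add: o_def)
    \<comment> \<open>Contractivity of \<open>\<sigma>\<^sub>t\<close> now makes \<open>g\<close> bounded on horizontal strips of finite height.\<close>
    have shift: "g (z + of_real t) = \<phi> (b * \<sigma> t (F z))" for z t
    proof (rule holomorphic_eq_if_eq_on_reals[OF shift_hol])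
      show "(\<lambda>z. \<phi> (b * \<sigma> t (F z))) holomorphic_on UNIV"
      proof (rule entire_functional_holomorphic[OF F(1)])
        show "bounded_linear (\<lambda>x. \<phi> (b * \<sigma> t x))"
          by (rule bounded_linear_compose[OF blL star_hom_linear(1)[OF hom]])
        show "\<phi> (b * \<sigma> t (c *\<^sub>C x)) = c * \<phi> (b * \<sigma> t x)" for c x
          by (simp only: star_hom_linear(2)[OF hom] scL)
      qed
      show "g (of_real u + of_real t) = \<phi> (b * \<sigma> t (F (of_real u)))" for u
        by (simp only: g_def F_add F(2) group add.commute[of t u])
    qed
    \<comment> \<open>The KMS condition is applied to \<open>\<sigma>\<^sub>t(a)\<close>, whose orbit is a translate of that of \<open>a\<close>.\<close>
    have top: "g (of_real t + \<i> * of_real \<beta>) = \<phi> (\<sigma> t a * b)" for t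
    proof -
      obtain G where G: "entire G" "\<And>u. G (of_real u) = \<sigma> u (\<sigma> t a)"
        "\<phi> (\<sigma> t a * b) = \<phi> (b * G (\<i> * of_real \<beta>))"
        using KMS[OF \<sigma>_D[OF a]] b unfolding analytic_orbit_def by blast
      have "g (\<i> * of_real \<beta> + of_real t) = \<phi> (b * G (\<i> * of_real \<beta>))"
      proof (rule holomorphic_eq_if_eq_on_reals[OF shift_hol])
        show "(\<lambda>z. \<phi> (b * G z)) holomorphic_on UNIV"
          by (rule entire_functional_holomorphic[OF G(1) blL]) (rule scL)
        show "g (of_real u + of_real t) = \<phi> (b * G (of_real u))" for u
          by (simp only: g_def F_add G(2) group)
      qed
      then show ?thesis using G(3) by (simp add: add.commute)
    qed
    have "continuous_on UNIV F"
      using entire_isCont[OF F(1)] by (simp add: continuous_at_imp_continuous_on)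
    then have "continuous_on (closed_segment 0 \<beta>) (\<lambda>y. F (\<i> * of_real y))"
      by (rule continuous_on_compose2) (auto intro!: continuous_intros)
    then have "compact ((\<lambda>y. F (\<i> * of_real y)) ` closed_segment 0 \<beta>)"
      by (intro compact_continuous_image compact_segment)
    then obtain M where M: "\<And>y. y \<in> closed_segment 0 \<beta> \<Longrightarrow> norm (F (\<i> * of_real y)) \<le> M"
      using compact_imp_bounded[THEN bounded_iff[THEN iffD1]] by (metis imageI)
    \<comment> \<open>The factor cancels the eigenvalue, so that \<open>h\<close> is nearly constant on both lines.\<close>
    define h where "h z = exp (- \<i> * of_real l * z) * g z" for z
    have norm_exp: "norm (exp (- \<i> * of_real l * (of_real t + \<i> * of_real y))) = exp (l * y)" for t y
      by simp
    have close: "norm (\<phi> (b * \<sigma> t a) - exp (\<i> * of_real (l * t)) * \<phi> (w * v)) \<le> ?e a b"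
      "norm (\<phi> (\<sigma> t a * b) - exp (\<i> * of_real (l * t)) * \<phi> (v * w)) \<le> ?e a b" for t
    proof -
      have \<sigma>v: "norm (\<sigma> t v) \<le> norm v" by (rule contractive)
      have \<sigma>a: "norm (\<sigma> t a - \<sigma> t v) \<le> norm (a - v)"
        using contractive[of t "a - v"] bounded_linear.linear[OF star_hom_linear(1)[OF hom]]
        by (simp add: linear_diff)
      have "norm (b * (\<sigma> t a - \<sigma> t v) + (b - w) * \<sigma> t v) \<le> ?e a b"
        by (intro order_trans[OF norm_triangle_ineq] add_mono order_trans[OF norm_mult_ineq]
            mult_mono \<sigma>a \<sigma>v) auto
      moreover have "b * (\<sigma> t a - \<sigma> t v) + (b - w) * \<sigma> t v
          = b * \<sigma> t a - exp (\<i> * of_real (l * t)) *\<^sub>C (w * v)"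
        unfolding eigen by (simp add: algebra_simps mult_scaleC_right flip: scaleC_add_right)
      ultimately have "norm (\<phi> (b * \<sigma> t a - exp (\<i> * of_real (l * t)) *\<^sub>C (w * v))) \<le> ?e a b"
        using cstar_state_norm_le[OF state] order_trans by metis
      then show "norm (\<phi> (b * \<sigma> t a) - exp (\<i> * of_real (l * t)) * \<phi> (w * v)) \<le> ?e a b"
        by (simp only: lin)
      have "norm ((\<sigma> t a - \<sigma> t v) * b + \<sigma> t v * (b - w)) \<le> norm (a - v) * norm b + norm v * norm (b - w)"
        by (intro order_trans[OF norm_triangle_ineq] add_mono order_trans[OF norm_mult_ineq]
            mult_mono \<sigma>a \<sigma>v) auto
      moreover have "(\<sigma> t a - \<sigma> t v) * b + \<sigma> t v * (b - w)
          = \<sigma> t a * b - exp (\<i> * of_real (l * t)) *\<^sub>C (v * w)"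
        unfolding eigen by (simp add: algebra_simps mult_scaleC_left flip: scaleC_add_right)
      ultimately have "norm (\<phi> (\<sigma> t a * b - exp (\<i> * of_real (l * t)) *\<^sub>C (v * w)))
          \<le> norm (a - v) * norm b + norm v * norm (b - w)"
        using cstar_state_norm_le[OF state] order_trans by metis
      then show "norm (\<phi> (\<sigma> t a * b) - exp (\<i> * of_real (l * t)) * \<phi> (v * w)) \<le> ?e a b"
        by (simp only: lin mult.commute)
    qed
    show ?thesis
    proof (rule strip_boundary_constants[of h _ _ \<beta> _ _ "exp \<bar>l * \<beta>\<bar> * (norm b * M)"])
      show "h holomorphic_on UNIV"
        unfolding h_def using g_hol by (intro holomorphic_intros)
      show "norm (h (of_real t) - \<phi> (w * v)) \<le> ?e a b" for t
      proof -
        have "exp (- \<i> * of_real l * of_real t) * exp (\<i> * of_real (l * t)) = 1"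
          unfolding mult_exp_exp by simp
        then have "h (of_real t) - \<phi> (w * v) = exp (- \<i> * of_real l * of_real t)
            * (\<phi> (b * \<sigma> t a) - exp (\<i> * of_real (l * t)) * \<phi> (w * v))"
          unfolding h_def g_def F(2)
          by (simp only: right_diff_distrib mult.assoc[symmetric] mult_1_left)
        moreover have "norm (exp (- \<i> * of_real l * complex_of_real t)) = 1" by simp
        ultimately show ?thesis using close(1)[of t] by (simp only: norm_mult mult_1_left)
      qed
      show "norm (h (of_real t + \<i> * of_real \<beta>) - exp (of_real (l * \<beta>)) * \<phi> (v * w))
          \<le> exp (l * \<beta>) * ?e a b" for t
      proof -
        have "exp (- \<i> * of_real l * (of_real t + \<i> * of_real \<beta>)) * exp (\<i> * of_real (l * t))
            = exp (complex_of_real (l * \<beta>))"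
          unfolding mult_exp_exp by (rule arg_cong[of _ _ exp]) (simp add: complex_eq_iff)
        then have "h (of_real t + \<i> * of_real \<beta>) - exp (of_real (l * \<beta>)) * \<phi> (v * w)
          = exp (- \<i> * of_real l * (of_real t + \<i> * of_real \<beta>))
            * (\<phi> (\<sigma> t a * b) - exp (\<i> * of_real (l * t)) * \<phi> (v * w))"
          unfolding h_def top by (simp only: right_diff_distrib mult.assoc[symmetric])
        then show ?thesis
          using close(2)[of t] by (simp only: norm_mult norm_exp mult_left_mono exp_ge_zero)
      qed
      show "norm (h (of_real t + \<i> * of_real y)) \<le> exp \<bar>l * \<beta>\<bar> * (norm b * M)"
        if y: "y \<in> closed_segment 0 \<beta>" for t y
      proof -
        have "\<bar>y\<bar> \<le> \<bar>\<beta>\<bar>" using y by (auto simp: closed_segment_eq_real_ivl split: if_splits)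
        then have "\<bar>l * y\<bar> \<le> \<bar>l * \<beta>\<bar>" by (simp add: abs_mult mult_left_mono)
        then have "l * y \<le> \<bar>l * \<beta>\<bar>" by linarith
        moreover have "norm (g (of_real t + \<i> * of_real y)) \<le> norm b * M"
        proof -
          have "norm (g (\<i> * of_real y + of_real t)) \<le> norm (b * \<sigma> t (F (\<i> * of_real y)))"
            unfolding shift by (rule cstar_state_norm_le[OF state])
          also have "\<dots> \<le> norm b * M"
            by (intro order_trans[OF norm_mult_ineq] mult_left_mono order_trans[OF contractive] M y) simp
          finally show ?thesis by (simp add: add.commute)
        qed
        ultimately show ?thesis
          unfolding h_def norm_mult norm_exp by (intro mult_mono) auto
      qed
    qed
  qed
  have dense: "\<exists>X. (\<forall>n. X n \<in> D) \<and> X \<longlonglongrightarrow> x" for x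
    using D(1) closure_sequential[of x D] by simp
  obtain A where A: "\<And>n. A n \<in> D" "A \<longlonglongrightarrow> v" using dense by blast
  obtain B where B: "\<And>n. B n \<in> D" "B \<longlonglongrightarrow> w" using dense by blast
  have "(\<lambda>n. ?e (A n) (B n)) \<longlonglongrightarrow> norm w * norm (v - v) + norm (w - w) * norm v"
    by (intro tendsto_intros A B)
  then have e0: "(\<lambda>n. ?e (A n) (B n)) \<longlonglongrightarrow> 0" by simp
  have "(\<lambda>n. ?e (A n) (B n) + exp (l * \<beta>) * ?e (A n) (B n)) \<longlonglongrightarrow> 0"
    by (rule tendsto_add_zero[OF e0 tendsto_mult_right_zero[OF e0]])
  then have "norm (\<phi> (w * v) - exp (of_real (l * \<beta>)) * \<phi> (v * w)) \<le> 0"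
    by (rule LIMSEQ_le_const) (intro exI allI impI approx A B)
  then show ?thesis by simp
qed


section \<open>KMS states for the dynamics defined by a scale\<close>

lemma star_hom_respects_relations:
  fixes f :: "'s::monoid_mult cstar \<Rightarrow> 'b::cstar_algebra"
  assumes "star_hom f" "(x, y) \<in> cstar_relations"
  shows "poly_eval (\<lambda>s. f (cstar_gen s)) x = poly_eval (\<lambda>s. f (cstar_gen s)) y"
  using star_hom_poly[OF assms(1)] cstar_of_poly_relation[OF assms(2)] by metis

lemma star_hom_eqI:
  fixes f g :: "'s::monoid_mult cstar \<Rightarrow> 'b::cstar_algebra"
  assumes "star_hom f" "star_hom g" "\<And>s. f (cstar_gen s) = g (cstar_gen s)"
  shows "f = g"
  using cstar_universal[OF star_hom_respects_relations[OF assms(1)]] assms by metis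

lemma star_hom_contractive:
  fixes f :: "'s::monoid_mult cstar \<Rightarrow> 'b::cstar_algebra"
  assumes f: "star_hom f"
  shows "norm (f x) \<le> norm x"
proof (cases x rule: cstar_cases)
  fix X assume X: "poly_cauchy X" "x = abs_cstar X"
  have lim: "(\<lambda>n. cstar_of_poly (X n)) \<longlonglongrightarrow> x" using poly_cauchy_limit[OF X(1)] X(2) by simp
  have "norm (f (cstar_of_poly (X n))) \<le> norm (cstar_of_poly (X n))" for n
    unfolding star_hom_poly[OF f refl] norm_cstar_of_poly
    by (rule poly_eval_le) (rule star_hom_respects_relations[OF f])
  then show ?thesis
    by (intro LIMSEQ_le[OF tendsto_norm[OF bounded_linear.tendsto[OF star_hom_linear(1)[OF f] lim]]
          tendsto_norm[OF lim]]) auto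
qed

lemma scale_dynamics_group:
  fixes N :: "'s::monoid_mult \<Rightarrow> real"
  assumes N: "semigroup_scale N"
  shows "scale_dynamics N t (scale_dynamics N u x) = scale_dynamics N (t + u) x"
proof -
  note props = scale_dynamics_props[OF N]
  have "star_hom (\<lambda>x. scale_dynamics N t (scale_dynamics N u x))"
    using props(1)[of t] props(1)[of u] unfolding star_hom_def
    by (simp add: bounded_linear_compose)
  then have "(\<lambda>x. scale_dynamics N t (scale_dynamics N u x)) = scale_dynamics N (t + u)"
    by (rule star_hom_eqI[OF _ props(1)])
      (simp add: props(2) star_hom_linear(2)[OF props(1)] scaleC_scaleC powr_add distrib_left
        mult.commute)
  then show ?thesis by metis
qed

lemma KMS_state_range_projection:
  fixes N :: "'s::monoid_mult \<Rightarrow> real"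
  assumes N: "semigroup_scale N" and \<phi>: "KMS_state (scale_dynamics N) \<beta> \<phi>"
  shows "\<phi> (cstar_gen s * star (cstar_gen s)) = of_real (N s powr (- \<beta>))"
proof -
  have pos: "N s > 0" using semigroup_scale_pos[OF N] .
  have state: "cstar_state \<phi>" using \<phi> by (simp add: KMS_state_def)
  have "\<phi> (star (cstar_gen s) * cstar_gen s)
      = exp (of_real (ln (N s) * \<beta>)) * \<phi> (cstar_gen s * star (cstar_gen s))"
  proof (rule KMS_eigenvector[OF \<phi>])
    show "star_hom (scale_dynamics N t)" for t by (rule scale_dynamics_props(1)[OF N])
    then show "norm (scale_dynamics N t x) \<le> norm x" for t x by (rule star_hom_contractive)
    show "scale_dynamics N t (scale_dynamics N u x) = scale_dynamics N (t + u) x" for t u x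
      by (rule scale_dynamics_group[OF N])
    show "scale_dynamics N t (cstar_gen s) = exp (\<i> * of_real (ln (N s) * t)) *\<^sub>C cstar_gen s" for t
      using pos by (simp add: scale_dynamics_props(2)[OF N] powr_def Ln_of_real mult_ac)
  qed
  then have "1 = of_real (N s powr \<beta>) * \<phi> (cstar_gen s * star (cstar_gen s))"
    using pos by (simp add: cstar_gen_relations cstar_state_1[OF state] powr_def mult.commute
        flip: exp_of_real)
  then show ?thesis using pos by (simp add: powr_minus field_simps)
qed

lemma KMS_state_condition:
  fixes N :: "'s::right_LCM_semigroup \<Rightarrow> real"
  assumes N: "semigroup_scale N" and \<phi>: "KMS_state (scale_dynamics N) \<beta> \<phi>"
  shows "N s powr (- \<beta>) \<le> 1"
    and "N t = 1 \<Longrightarrow>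
      \<exists>r. right_ideal s \<inter> right_ideal t = right_ideal r \<and> N s powr (- \<beta>) \<le> N r powr (- \<beta>)"
proof -
  have state: "cstar_state \<phi>" using \<phi> by (simp add: KMS_state_def)
  note lin = cstar_state_linear[OF state]
  define e where "e s = cstar_gen s * star (cstar_gen s)" for s :: 's
  have \<phi>e: "\<phi> (e s) = of_real (N s powr (- \<beta>))" for s
    unfolding e_def by (rule KMS_state_range_projection[OF N \<phi>])
  have star_e: "star (e s) = e s" for s
    by (simp add: e_def star_mult star_star)
  have e_e: "e s * e s = e s" for s
    using cstar_gen_relations(4)[of s s s] by (simp add: e_def)
  show "N s powr (- \<beta>) \<le> 1"
  proof -
    have "Re (\<phi> (star (1 - e s) * (1 - e s))) = 1 - N s powr (- \<beta>)"
      by (simp add: star_diff star_e algebra_simps e_e lin \<phi>e cstar_state_1[OF state])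
    then show ?thesis using cstar_state_positive(2)[OF state, of "1 - e s"] by simp
  qed
  show "\<exists>r. right_ideal s \<inter> right_ideal t = right_ideal r \<and> N s powr (- \<beta>) \<le> N r powr (- \<beta>)"
    if t: "N t = 1"
  proof -
    have "\<phi> (star (1 - e t) * (1 - e t)) = 0"
      by (simp add: star_diff star_e algebra_simps e_e lin \<phi>e cstar_state_1[OF state] t)
    then have "\<phi> (star (e s) * (1 - e t)) = 0"
      using cstar_state_Cauchy_Schwarz[OF state, of "e s" "1 - e t"] by simp
    then have eq: "\<phi> (e s * e t) = of_real (N s powr (- \<beta>))"
      by (simp add: star_e right_diff_distrib lin \<phi>e)
    have "right_ideal s \<inter> right_ideal t \<noteq> {}"
    proof
      assume "right_ideal s \<inter> right_ideal t = {}"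
      then have "e s * e t = 0" unfolding e_def by (rule cstar_gen_relations(5))
      then show False using eq semigroup_scale_pos[OF N, of s] by (simp add: lin)
    qed
    then obtain r where r: "right_ideal s \<inter> right_ideal t = right_ideal r"
      using right_LCM by blast
    then have "e s * e t = e r" unfolding e_def by (rule cstar_gen_relations(4))
    then have "N s powr (- \<beta>) = N r powr (- \<beta>)" using eq \<phi>e[of r] by (metis of_real_eq_iff)
    then show ?thesis using r by auto
  qed
qed

theorem lemma3p1:
  fixes N :: "'s::right_LCM_semigroup \<Rightarrow> real" and \<beta> :: real
  assumes "countable (UNIV :: 's set)"
    and "semigroup_scale N"
    and "\<exists>s. N s \<noteq> 1"
  shows "(\<exists>\<mu>. scaling_measure N \<beta> \<mu>) \<or> (\<exists>\<phi>. KMS_state (scale_dynamics N) \<beta> \<phi>) \<longrightarrow>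
    \<beta> = 0 \<or>
    (\<beta> > 0 \<and> (\<forall>s. \<forall>t\<in>scale_kernel N.
       \<exists>r\<in>(*) s ` scale_kernel N. right_ideal s \<inter> right_ideal t = right_ideal r))"
  using scale_conditionI[OF assms(2,3)] scaling_measure_condition[OF assms(2)]
    KMS_state_condition[OF assms(2)] by meson

end
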